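(* If $\mathcal E\subseteq\omega^\omega$ is an analytic maximal eventually different family and $\mathbb P$ is any forcing notion adding a new real, then $\Vdash_{\mathbb P}$ "$\check{\mathcal E}$ is not a maximal eventually different family". In particular, no tight eventually different family is analytic.
   Context: For $f,g\in\omega^\omega$, $f\neq^* g$ means there is $k<\omega$ with $f(n)\neq g(n)$ for all $n>k$. A set $\mathcal E\subseteq\omega^\omega$ is an eventually different family if $f\neq^* g$ for all distinct $f,g\in\mathcal E$; it is maximal if it is not properly contained in another eventually different family. A tree is a set $T\subseteq\omega^{<\omega}$ closed under initial segments and pruned. Functions and finite sequences are identified with their graphs; for $t\in T$ let $T_t=\{s\in T: s\subseteq t\text{ or }t\subseteq s\}$. $\mathcal I_T(\mathcal E)^+$ is the set of trees $T$ such that for no $t\in T$ and no finite $X\subseteq\mathcal E$ is $\bigcup T_t\setminus\bigcup X$ finite. A function $g$ densely diagonalizes a tree $T$ if for every $t\in T$ there are $s\in T$, $s\supsetneq t$, and $k\in\mathrm{dom}(s)\setminus\mathrm{dom}(t)$ with $s(k)=g(k)$. $\mathcal E$ is tight if every countable family of trees in $\mathcal I_T(\mathcal E)^+$ is densely diagonalized by a single $g\in\mathcal E$. *)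

theory Defs
  imports "HOL-Analysis.Analysis" "HOL-Library.Sublist"
begin

section \<open>Eventually different families\<close>

definition ev_diff :: "(nat \<Rightarrow> nat) \<Rightarrow> (nat \<Rightarrow> nat) \<Rightarrow> bool" where
  "ev_diff f g \<longleftrightarrow> (\<exists>k. \<forall>n>k. f n \<noteq> g n)"

definition ed_family :: "(nat \<Rightarrow> nat) set \<Rightarrow> bool" where
  "ed_family E \<longleftrightarrow> (\<forall>f\<in>E. \<forall>g\<in>E. f \<noteq> g \<longrightarrow> ev_diff f g)"

definition maximal_ed_family :: "(nat \<Rightarrow> nat) set \<Rightarrow> bool" where
  "maximal_ed_family E \<longleftrightarrow> ed_family E \<and> \<not> (\<exists>F. ed_family F \<and> E \<subset> F)"

text \<open>Boldface \<open>\<Sigma>\<close>-1-1 sets: projections of closed subsets of the square of Baire space. The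
  type \<^typ>\<open>nat \<Rightarrow> nat\<close> carries the product topology of the discrete topology on \<^typ>\<open>nat\<close>.\<close>

definition analytic_set :: "(nat \<Rightarrow> nat) set \<Rightarrow> bool" where
  "analytic_set A \<longleftrightarrow> (\<exists>C :: ((nat \<Rightarrow> nat) \<times> (nat \<Rightarrow> nat)) set. closed C \<and> A = fst ` C)"


section \<open>Trees and tightness\<close>

definition is_tree :: "nat list set \<Rightarrow> bool" where
  "is_tree T \<longleftrightarrow>
     (\<forall>t\<in>T. \<forall>s. prefix s t \<longrightarrow> s \<in> T) \<and>
     (\<forall>t\<in>T. \<exists>s\<in>T. strict_prefix t s)"

definition subtree_at :: "nat list set \<Rightarrow> nat list \<Rightarrow> nat list set" where
  "subtree_at T t = {s \<in> T. prefix s t \<or> prefix t s}"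

definition seq_graph :: "nat list \<Rightarrow> (nat \<times> nat) set" where
  "seq_graph s = {(i, s ! i) | i. i < length s}"

definition fun_graph :: "(nat \<Rightarrow> nat) \<Rightarrow> (nat \<times> nat) set" where
  "fun_graph f = {(i, f i) | i. True}"

definition I_T_plus :: "(nat \<Rightarrow> nat) set \<Rightarrow> nat list set set" where
  "I_T_plus E = {T. is_tree T \<and>
     \<not> (\<exists>t\<in>T. \<exists>X. finite X \<and> X \<subseteq> E \<and>
          finite (\<Union> (seq_graph ` subtree_at T t) - \<Union> (fun_graph ` X)))}"

definition densely_diagonalizes :: "(nat \<Rightarrow> nat) \<Rightarrow> nat list set \<Rightarrow> bool" where
  "densely_diagonalizes g T \<longleftrightarrow>
     (\<forall>t\<in>T. \<exists>s\<in>T. strict_prefix t s \<and> (\<exists>k. length t \<le> k \<and> k < length s \<and> s ! k = g k))"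

definition tight :: "(nat \<Rightarrow> nat) set \<Rightarrow> bool" where
  "tight E \<longleftrightarrow>
     (\<forall>\<T>. countable \<T> \<and> \<T> \<subseteq> I_T_plus E \<longrightarrow> (\<exists>g\<in>E. \<forall>T\<in>\<T>. densely_diagonalizes g T))"


section \<open>Forcing\<close>

text \<open>The ground model is the universe of HOL. A forcing notion is a nonempty preorder on a carrier
  \<open>P\<close>, where \<open>le q p\<close> says that \<open>q\<close> is stronger than \<open>p\<close>. No largest element is required, so a
  sentence is forced by the forcing notion if all conditions force it; if there is a largest
  condition this is the same as being forced by that condition.\<close>

definition forcing_notion :: "'p set \<Rightarrow> ('p \<Rightarrow> 'p \<Rightarrow> bool) \<Rightarrow> bool" where
  "forcing_notion P le \<longleftrightarrow> P \<noteq> {} \<and> reflp_on P le \<and> transp_on P le"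

text \<open>Names are typed. A name for a subset of \<open>\<omega> \<times> \<omega>\<close> is a set of pairs (element, condition), and a
  name for a family of such subsets is a set of pairs (name, condition). Every subset of
  \<open>\<omega> \<times> \<omega>\<close>, and every family of such subsets, that lies in a generic extension is the value of
  such a name, so the quantifiers of the forcing language range over all of them. Pairs whose second
  component lies outside the carrier are ignored by the forcing relation.\<close>

type_synonym 'p rname = "((nat \<times> nat) \<times> 'p) set"
type_synonym 'p fname = "('p rname \<times> 'p) set"

text \<open>Sentences of the forcing language. \<open>Val n m x\<close> is \<open>(n, m) \<in> x\<close>, \<open>Mem x A\<close> is \<open>x \<in> A\<close>, and
  \<open>Ground b\<close> is a statement about natural numbers decided in the ground model. The three
  quantifiers range over the natural numbers (the same in the ground model and in the extension),
  the subsets of \<open>\<omega> \<times> \<omega>\<close>, and the families of such subsets; a quantified formula is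
  represented by the function giving its instances.\<close>

datatype 'p sentence =
    Ground bool
  | Val nat nat "'p rname"
  | Mem "'p rname" "'p fname"
  | Neg "'p sentence"
  | Conj "'p sentence" "'p sentence"
  | All_nat "nat \<Rightarrow> 'p sentence"
  | All_real "'p rname \<Rightarrow> 'p sentence"
  | All_fam "'p fname \<Rightarrow> 'p sentence"

definition forces_val ::
  "'p set \<Rightarrow> ('p \<Rightarrow> 'p \<Rightarrow> bool) \<Rightarrow> 'p \<Rightarrow> nat \<Rightarrow> nat \<Rightarrow> 'p rname \<Rightarrow> bool" where
  "forces_val P le p n m x \<longleftrightarrow>
     (\<forall>q\<in>P. le q p \<longrightarrow> (\<exists>r\<in>P. le r q \<and> (\<exists>s\<in>P. ((n, m), s) \<in> x \<and> le r s)))"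

definition forces_eq ::
  "'p set \<Rightarrow> ('p \<Rightarrow> 'p \<Rightarrow> bool) \<Rightarrow> 'p \<Rightarrow> 'p rname \<Rightarrow> 'p rname \<Rightarrow> bool" where
  "forces_eq P le p x y \<longleftrightarrow>
     (\<forall>n m. \<forall>q\<in>P. le q p \<longrightarrow> (forces_val P le q n m x \<longleftrightarrow> forces_val P le q n m y))"

definition forces_mem ::
  "'p set \<Rightarrow> ('p \<Rightarrow> 'p \<Rightarrow> bool) \<Rightarrow> 'p \<Rightarrow> 'p rname \<Rightarrow> 'p fname \<Rightarrow> bool" where
  "forces_mem P le p x A \<longleftrightarrow>
     (\<forall>q\<in>P. le q p \<longrightarrow>
       (\<exists>r\<in>P. le r q \<and> (\<exists>y. \<exists>s\<in>P. (y, s) \<in> A \<and> le r s \<and> forces_eq P le r x y)))"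

primrec forces :: "'p set \<Rightarrow> ('p \<Rightarrow> 'p \<Rightarrow> bool) \<Rightarrow> 'p \<Rightarrow> 'p sentence \<Rightarrow> bool" where
  "forces P le p (Ground b) \<longleftrightarrow> b"
| "forces P le p (Val n m x) \<longleftrightarrow> forces_val P le p n m x"
| "forces P le p (Mem x A) \<longleftrightarrow> forces_mem P le p x A"
| "forces P le p (Neg \<phi>) \<longleftrightarrow> (\<forall>q\<in>P. le q p \<longrightarrow> \<not> forces P le q \<phi>)"
| "forces P le p (Conj \<phi> \<psi>) \<longleftrightarrow> forces P le p \<phi> \<and> forces P le p \<psi>"
| "forces P le p (All_nat \<Phi>) \<longleftrightarrow> (\<forall>n. forces P le p (\<Phi> n))"
| "forces P le p (All_real \<Phi>) \<longleftrightarrow> (\<forall>x. forces P le p (\<Phi> x))"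
| "forces P le p (All_fam \<Phi>) \<longleftrightarrow> (\<forall>A. forces P le p (\<Phi> A))"

definition forced :: "'p set \<Rightarrow> ('p \<Rightarrow> 'p \<Rightarrow> bool) \<Rightarrow> 'p sentence \<Rightarrow> bool" where
  "forced P le \<phi> \<longleftrightarrow> (\<forall>p\<in>P. forces P le p \<phi>)"

definition check_real :: "'p set \<Rightarrow> (nat \<Rightarrow> nat) \<Rightarrow> 'p rname" where
  "check_real P f = {((n, f n), p) | n p. p \<in> P}"

definition check_fam :: "'p set \<Rightarrow> (nat \<Rightarrow> nat) set \<Rightarrow> 'p fname" where
  "check_fam P E = {(check_real P f, p) | f p. f \<in> E \<and> p \<in> P}"

definition Imp :: "'p sentence \<Rightarrow> 'p sentence \<Rightarrow> 'p sentence" where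
  "Imp \<phi> \<psi> = Neg (Conj \<phi> (Neg \<psi>))"

definition Ex_nat :: "(nat \<Rightarrow> 'p sentence) \<Rightarrow> 'p sentence" where
  "Ex_nat \<Phi> = Neg (All_nat (\<lambda>n. Neg (\<Phi> n)))"

definition Ex_real :: "('p rname \<Rightarrow> 'p sentence) \<Rightarrow> 'p sentence" where
  "Ex_real \<Phi> = Neg (All_real (\<lambda>x. Neg (\<Phi> x)))"

definition Ex_fam :: "('p fname \<Rightarrow> 'p sentence) \<Rightarrow> 'p sentence" where
  "Ex_fam \<Phi> = Neg (All_fam (\<lambda>A. Neg (\<Phi> A)))"

definition Eq_real :: "'p rname \<Rightarrow> 'p rname \<Rightarrow> 'p sentence" where
  "Eq_real x y =
     All_nat (\<lambda>n. All_nat (\<lambda>m. Conj (Imp (Val n m x) (Val n m y)) (Imp (Val n m y) (Val n m x))))"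

text \<open>\<open>x\<close> is (the graph of) a function from \<open>\<omega>\<close> to \<open>\<omega>\<close>.\<close>

definition Is_fun :: "'p rname \<Rightarrow> 'p sentence" where
  "Is_fun x =
     All_nat (\<lambda>n. Conj
       (Ex_nat (\<lambda>m. Val n m x))
       (All_nat (\<lambda>m. All_nat (\<lambda>m'. Imp (Conj (Val n m x) (Val n m' x)) (Ground (m = m'))))))"

text \<open>\<open>Ev_diff\<close>, \<open>Ed_family\<close> and \<open>Maximal_ed_family\<close> are \<^const>\<open>ev_diff\<close>, \<^const>\<open>ed_family\<close>
  and \<^const>\<open>maximal_ed_family\<close> written in the forcing language, with functions given by their
  graphs.\<close>

definition Ev_diff :: "'p rname \<Rightarrow> 'p rname \<Rightarrow> 'p sentence" where
  "Ev_diff x y =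
     Ex_nat (\<lambda>k. All_nat (\<lambda>n. Imp (Ground (k < n))
       (All_nat (\<lambda>m. All_nat (\<lambda>m'. Imp (Conj (Val n m x) (Val n m' y)) (Ground (m \<noteq> m')))))))"

definition Ed_family :: "'p fname \<Rightarrow> 'p sentence" where
  "Ed_family A = Conj
     (All_real (\<lambda>x. Imp (Mem x A) (Is_fun x)))
     (All_real (\<lambda>x. All_real (\<lambda>y.
        Imp (Conj (Mem x A) (Mem y A)) (Imp (Neg (Eq_real x y)) (Ev_diff x y)))))"

definition Proper_subfam :: "'p fname \<Rightarrow> 'p fname \<Rightarrow> 'p sentence" where
  "Proper_subfam A B = Conj
     (All_real (\<lambda>x. Imp (Mem x A) (Mem x B)))
     (Ex_real (\<lambda>x. Conj (Mem x B) (Neg (Mem x A))))"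

definition Maximal_ed_family :: "'p fname \<Rightarrow> 'p sentence" where
  "Maximal_ed_family A =
     Conj (Ed_family A) (Neg (Ex_fam (\<lambda>B. Conj (Ed_family B) (Proper_subfam A B))))"

definition adds_new_real :: "'p set \<Rightarrow> ('p \<Rightarrow> 'p \<Rightarrow> bool) \<Rightarrow> bool" where
  "adds_new_real P le \<longleftrightarrow>
     forced P le (Ex_real (\<lambda>x. Conj (Is_fun x) (Neg (Mem x (check_fam P UNIV)))))"

end

theory Submission
  imports Defs
begin

text \<open>An uncountable analytic set \<open>E\<close> contains a perfect set, given as the range of an embedding
  \<open>F\<close> of Cantor space. A maximal eventually different family and a tight one are both uncountable, by
  diagonalizing against an enumeration.

  If a new real is added, \<open>F\<close> maps it to a new real \<open>x\<close>. If \<open>x\<close> were forced to agree infinitely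
  often with some \<open>e \<in> E\<close>, then a decreasing sequence of conditions deciding longer and longer initial
  segments and infinitely many agreements would give a ground model element of \<open>range F \<subseteq> E\<close>, different
  from \<open>e\<close>, that agrees infinitely often with \<open>e\<close>. Hence \<open>E \<union> {x}\<close> is eventually different in the
  extension.

  If \<open>E\<close> is tight, the tree of \<open>range F\<close> is in \<open>\<I>\<^sub>T(E)\<^sup>+\<close>, and a member \<open>g\<close> of \<open>E\<close> that densely
  diagonalizes it agrees infinitely often with a branch other than \<open>g\<close>, which also lies in \<open>E\<close>.\<close>

section \<open>Initial segments of infinite sequences\<close>

definition init :: "(nat \<Rightarrow> 'a) \<Rightarrow> nat \<Rightarrow> 'a list" where
  "init z n = map z [0..<n]"

lemma length_init [simp]: "length (init z n) = n"
  by (simp add: init_def)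

lemma nth_init [simp]: "i < n \<Longrightarrow> init z n ! i = z i"
  by (simp add: init_def)

lemma init_0 [simp]: "init z 0 = []"
  by (simp add: init_def)

lemma init_Suc: "init z (Suc n) = init z n @ [z n]"
  by (simp add: init_def)

lemma eq_init_iff: "w = init z n \<longleftrightarrow> length w = n \<and> (\<forall>i<n. w ! i = z i)"
  by (auto simp: list_eq_iff_nth_eq)

lemma init_eq_iff: "init z n = init z' n \<longleftrightarrow> (\<forall>i<n. z i = z' i)"
  by (auto simp: list_eq_iff_nth_eq)

lemma prefix_iff_nth:
  "prefix s t \<longleftrightarrow> length s \<le> length t \<and> (\<forall>i<length s. s ! i = t ! i)"
proof
  assume "prefix s t"
  then show "length s \<le> length t \<and> (\<forall>i<length s. s ! i = t ! i)"
    by (auto simp: prefix_def nth_append)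
next
  assume "length s \<le> length t \<and> (\<forall>i<length s. s ! i = t ! i)"
  then have "s = take (length s) t"
    by (auto simp: list_eq_iff_nth_eq)
  then show "prefix s t"
    by (metis take_is_prefix)
qed

lemma prefix_init_iff: "prefix w (init z n) \<longleftrightarrow> length w \<le> n \<and> w = init z (length w)"
  by (auto simp: prefix_iff_nth list_eq_iff_nth_eq)

section \<open>The perfect set property of analytic sets\<close>

lemma tendsto_fun:
  fixes f :: "'b \<Rightarrow> 'i \<Rightarrow> 'a::topological_space"
  assumes "\<And>i. ((\<lambda>x. f x i) \<longlongrightarrow> l i) F"
  shows "(f \<longlongrightarrow> l) F"
proof -
  have "limitin (product_topology (\<lambda>_. euclidean) UNIV) f l F"
    using assms by (auto simp: limitin_componentwise)
  then show ?thesis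
    by (simp add: euclidean_product_topology)
qed

text \<open>Closedness in a power of a discrete space, phrased through initial segments so that the
  tree construction below needs no topology.\<close>

definition closed_under_approx :: "(nat \<Rightarrow> 'a) set \<Rightarrow> bool" where
  "closed_under_approx Z \<longleftrightarrow> (\<forall>z. (\<forall>n. \<exists>z'\<in>Z. init z' n = init z n) \<longrightarrow> z \<in> Z)"

text \<open>The pair of sequences in \<open>C\<close> is merged into one sequence of pairs, so that
  a single finite sequence approximates the point and its witness at once. A point approximated by
  \<open>Z\<close> is the limit of members of \<open>Z\<close>, hence closedness of \<open>C\<close>
  applies.\<close>

lemma analytic_set_projection:
  assumes "analytic_set E"
  obtains Z :: "(nat \<Rightarrow> nat \<times> nat) set"
  where "closed_under_approx Z" "E = (\<lambda>z. fst \<circ> z) ` Z"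
proof -
  obtain C :: "((nat \<Rightarrow> nat) \<times> (nat \<Rightarrow> nat)) set" where C: "closed C" "E = fst ` C"
    using assms unfolding analytic_set_def by blast
  define Z where "Z = {z. (fst \<circ> z, snd \<circ> z) \<in> C}"
  have "z \<in> Z" if *: "\<forall>n. \<exists>z'\<in>Z. init z' n = init z n" for z
  proof -
    obtain w where w: "\<And>n. w n \<in> Z" "\<And>n. init (w n) n = init z n"
      using * by metis
    \<comment> \<open>Every coordinate is eventually constant along \<open>w\<close>, which gives
      convergence coordinate by coordinate.\<close>
    have ev: "eventually (\<lambda>n. w n i = z i) sequentially" for i
      using w(2) by (auto simp: init_eq_iff eventually_sequentially intro!: exI[of _ "Suc i"])
    have "(\<lambda>n. p \<circ> w n) \<longlonglongrightarrow> (p \<circ> z)" for p :: "nat \<times> nat \<Rightarrow> nat"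
    proof (rule tendsto_fun)
      show "(\<lambda>n. (p \<circ> w n) i) \<longlonglongrightarrow> (p \<circ> z) i" for i
        using ev[of i] by (auto intro!: tendsto_eventually elim: eventually_mono)
    qed
    then have "(\<lambda>n. (fst \<circ> w n, snd \<circ> w n)) \<longlonglongrightarrow> (fst \<circ> z, snd \<circ> z)"
      by (intro tendsto_Pair) auto
    moreover have "(fst \<circ> w n, snd \<circ> w n) \<in> C" for n
      using w(1) by (simp add: Z_def)
    ultimately show ?thesis
      using closed_sequentially[OF C(1), of "\<lambda>n. (fst \<circ> w n, snd \<circ> w n)"]
      by (simp add: Z_def)
  qed
  moreover have "E = (\<lambda>z. fst \<circ> z) ` Z"
  proof -
    have "x \<in> (\<lambda>z. fst \<circ> z) ` Z" if "(x, y) \<in> C" for x y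
      using that by (intro image_eqI[of _ _ "\<lambda>n. (x n, y n)"]) (auto simp: Z_def comp_def)
    then show ?thesis
      unfolding C(2) by (force simp: Z_def)
  qed
  ultimately show ?thesis
    using that unfolding closed_under_approx_def by blast
qed

context
  fixes Z :: "(nat \<Rightarrow> 'a::countable \<times> 'b::countable) set"
begin

definition shadow :: "('a \<times> 'b) list \<Rightarrow> (nat \<Rightarrow> 'a) set" where
  "shadow w = {fst \<circ> z | z. z \<in> Z \<and> init z (length w) = w}"

text \<open>Discarding from the shadow of \<open>w\<close> the countably many countable shadows leaves points whose
  preimages only have initial segments with uncountable shadow.\<close>

lemma shadow_splits:
  assumes "uncountable (shadow w)"
  shows "\<exists>w0 w1. strict_prefix w w0 \<and> strict_prefix w w1 \<and> length w0 = length w1 \<and>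
    map fst w0 \<noteq> map fst w1 \<and> uncountable (shadow w0) \<and> uncountable (shadow w1)"
proof -
  define S where "S = shadow w - \<Union> (shadow ` {v. countable (shadow v)})"
  have "countable (\<Union> (shadow ` {v. countable (shadow v)}))"
    by auto
  then have "uncountable S"
    unfolding S_def using assms uncountable_minus_countable by blast
  then obtain x where x: "x \<in> S"
    by (metis countable_empty equals0I)
  have "uncountable (S - {x})"
    using \<open>uncountable S\<close> by (simp add: uncountable_minus_countable)
  then obtain x' where x': "x' \<in> S" "x' \<noteq> x"
    by (metis Diff_iff countable_empty equals0I insertI1)
  obtain z where z: "x = fst \<circ> z" "z \<in> Z" "init z (length w) = w"
    using x unfolding S_def shadow_def by blast
  obtain z' where z': "x' = fst \<circ> z'" "z' \<in> Z" "init z' (length w) = w"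
    using x' unfolding S_def shadow_def by blast
  obtain k where k: "x k \<noteq> x' k"
    using x'(2) by (metis ext)
  \<comment> \<open>Beyond \<open>k\<close> the two projections differ, beyond
    \<open>length w\<close> both extensions are strict; a common \<open>n\<close> makes their
    lengths equal.\<close>
  define n where "n = Suc (max k (length w))"
  have unc: "uncountable (shadow (init z n))" "uncountable (shadow (init z' n))"
  proof -
    have "x \<in> shadow (init z n)" "x' \<in> shadow (init z' n)"
      unfolding shadow_def using z z' by auto
    then show "uncountable (shadow (init z n))" "uncountable (shadow (init z' n))"
      using x x'(1) unfolding S_def by blast+
  qed
  have "strict_prefix w (init z n)" "strict_prefix w (init z' n)"
    using z(3) z'(3) by (auto simp: strict_prefix_def prefix_init_iff n_def eq_init_iff)
  moreover have "map fst (init z n) ! k \<noteq> map fst (init z' n) ! k"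
    using k z(1) z'(1) by (simp add: n_def)
  ultimately show ?thesis
    using unc by (metis length_init)
qed

text \<open>A Cantor scheme: the bits of \<open>c\<close> select one of two extensions with
  uncountable shadow at each level. Nonempty shadows and closedness put the limit into
  \<open>Z\<close>; since siblings have equal length but different first coordinates,
  \<open>c\<close> can be read off from the projection of the limit.\<close>

lemma projection_contains_cantor_set:
  assumes Z: "closed_under_approx Z" and unc: "uncountable ((\<lambda>z. fst \<circ> z) ` Z)"
  obtains F :: "(nat \<Rightarrow> bool) \<Rightarrow> nat \<Rightarrow> 'a"
  where "range F \<subseteq> (\<lambda>z. fst \<circ> z) ` Z"
    "\<And>c c' n. init c (Suc n) = init c' (Suc n) \<Longrightarrow> F c n = F c' n"
    "\<And>c n. \<exists>m. \<forall>c'. init (F c') m = init (F c) m \<longrightarrow> init c' n = init c n"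
proof -
  define ok where "ok w \<longleftrightarrow> uncountable (shadow w)" for w
  have "\<forall>w. \<exists>w0 w1. ok w \<longrightarrow> strict_prefix w w0 \<and> strict_prefix w w1 \<and> length w0 = length w1 \<and>
    map fst w0 \<noteq> map fst w1 \<and> ok w0 \<and> ok w1"
    unfolding ok_def by (intro allI) (simp only: ex_simps(6), blast intro: shadow_splits)
  then obtain L R where LR: "\<And>w. ok w \<Longrightarrow> strict_prefix w (L w) \<and> strict_prefix w (R w) \<and>
      length (L w) = length (R w) \<and> map fst (L w) \<noteq> map fst (R w) \<and> ok (L w) \<and> ok (R w)"
    by metis
  define W where "W c = rec_nat [] (\<lambda>n w. if c n then R w else L w)" for c :: "nat \<Rightarrow> bool"
  have W_0: "W c 0 = []" and W_Suc: "W c (Suc n) = (if c n then R (W c n) else L (W c n))" for c n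
    by (simp_all add: W_def)
  have "shadow [] = (\<lambda>z. fst \<circ> z) ` Z"
    unfolding shadow_def by auto
  then have "ok []"
    using unc by (simp add: ok_def)
  then have ok: "ok (W c n)" for c n
    by (induction n) (use LR in \<open>auto simp: W_0 W_Suc\<close>)
  have step: "strict_prefix (W c n) (W c (Suc n))" for c n
    using LR[OF ok[of c n]] by (simp add: W_Suc)
  have pre: "prefix (W c m) (W c n)" if "m \<le> n" for c m n
    using that
    by (induction n rule: dec_induct)
      (use step prefix_order.order_trans prefix_order.less_imp_le in \<open>blast+\<close>)
  have len: "n \<le> length (W c n)" for c n
    by (induction n) (use step in \<open>auto dest!: prefix_length_less Suc_leI intro: le_trans\<close>)
  have W_cong: "W c n = W c' n" if "init c n = init c' n" for c c' n
    using that by (induction n) (auto simp: W_0 W_Suc init_Suc)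
  \<comment> \<open>The node at level \<open>Suc i\<close> has length at least \<open>Suc i\<close>
    and depends only on the first \<open>Suc i\<close> bits of \<open>c\<close>. This yields the
    Lipschitz modulus.\<close>
  define G where "G c i = W c (Suc i) ! i" for c i
  have G: "W c n ! i = G c i" if "i < length (W c n)" for c i n
  proof -
    have "i < length (W c (Suc i))"
      using len[of "Suc i" c] by simp
    then show ?thesis
      unfolding G_def using that pre[of n "Suc i" c] pre[of "Suc i" n c]
      by (metis nle_le prefix_iff_nth)
  qed
  have W_init: "W c n = init (G c) (length (W c n))" for c n
    using G by (auto simp: list_eq_iff_nth_eq)
  have "G c \<in> Z" for c
  proof -
    \<comment> \<open>A point of \<open>Z\<close> through \<open>W c n\<close> agrees with
      \<open>G c\<close> on at least \<open>n\<close> places.\<close>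
    have "\<exists>z'\<in>Z. init z' n = init (G c) n" for n
    proof -
      have "shadow (W c n) \<noteq> {}"
        using ok[of c n] unfolding ok_def by auto
      then obtain z where "z \<in> Z" "init z (length (W c n)) = W c n"
        unfolding shadow_def by blast
      then show ?thesis
        using W_init[of c n] len[of n c] unfolding init_eq_iff
        by (metis init_eq_iff le_trans linorder_not_le)
    qed
    then show ?thesis
      using Z unfolding closed_under_approx_def by blast
  qed
  then have "range (\<lambda>c. fst \<circ> G c) \<subseteq> (\<lambda>z. fst \<circ> z) ` Z"
    by auto
  moreover have "(fst \<circ> G c) n = (fst \<circ> G c') n" if "init c (Suc n) = init c' (Suc n)" for c c' n
    using W_cong[OF that] by (simp add: G_def)
  moreover have "\<exists>m. \<forall>c'. init (fst \<circ> G c') m = init (fst \<circ> G c) m \<longrightarrow> init c' n = init c n" for c n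
  proof (intro exI allI impI)
    fix c'
    \<comment> \<open>The witness for \<open>m\<close> is the length of \<open>W c n\<close>, the
      node reached by the first \<open>n\<close> bits.\<close>
    assume eq: "init (fst \<circ> G c') (length (W c n)) = init (fst \<circ> G c) (length (W c n))"
    \<comment> \<open>While the bits agree, both paths are at the same node. Its two children have
      equal length at most \<open>m\<close> and distinct projections, so agreement of the projected
      limits forces the next bit to agree.\<close>
    have "init c' k = init c k" if "k \<le> n" for k
      using that
    proof (induction k)
      case (Suc k)
      then have k: "init c' k = init c k"
        by simp
      have Wk: "W c' k = W c k"
        using W_cong[OF k] .
      have lenk: "length (W c' (Suc k)) = length (W c (Suc k))"
        using LR[OF ok[of c k]] by (simp add: W_Suc Wk)
      have le: "length (W c (Suc k)) \<le> length (W c n)"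
        using Suc.prems pre by (simp add: prefix_length_le)
      have "map fst (W c' (Suc k)) = map fst (W c (Suc k))"
      proof (rule nth_equalityI)
        fix i
        assume "i < length (map fst (W c' (Suc k)))"
        then show "map fst (W c' (Suc k)) ! i = map fst (W c (Suc k)) ! i"
          using eq lenk le by (simp add: G init_eq_iff)
      qed (use lenk in simp)
      then have "c' k = c k"
        using LR[OF ok[of c k]] by (auto simp: W_Suc Wk split: if_splits)
      then show ?case
        using k by (simp add: init_Suc)
    qed simp
    then show "init c' n = init c n"
      by simp
  qed
  ultimately show ?thesis
    using that[of "\<lambda>c. fst \<circ> G c"] by blast
qed

end

text \<open>An embedding of Cantor space, with a Lipschitz modulus of continuity that needs no compactness
  argument, and with a continuous inverse.\<close>

definition cantor_embedding :: "((nat \<Rightarrow> bool) \<Rightarrow> nat \<Rightarrow> 'a) \<Rightarrow> bool" where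
  "cantor_embedding F \<longleftrightarrow>
     (\<forall>c c' n. init c (Suc n) = init c' (Suc n) \<longrightarrow> F c n = F c' n) \<and>
     (\<forall>c n. \<exists>m. \<forall>c'. init (F c') m = init (F c) m \<longrightarrow> init c' n = init c n)"

lemma cantor_embedding_inj:
  assumes "cantor_embedding F" "F c = F c'"
  shows "c = c'"
proof
  fix n
  have "init c' (Suc n) = init c (Suc n)"
    using assms unfolding cantor_embedding_def by metis
  then show "c n = c' n"
    by (simp add: init_Suc)
qed

theorem analytic_perfect_set:
  assumes "analytic_set E" "uncountable E"
  obtains F where "cantor_embedding F" "range F \<subseteq> E"
proof -
  obtain Z :: "(nat \<Rightarrow> nat \<times> nat) set"
    where Z: "closed_under_approx Z" "E = (\<lambda>z. fst \<circ> z) ` Z"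
    using analytic_set_projection[OF assms(1)] .
  obtain F :: "(nat \<Rightarrow> bool) \<Rightarrow> nat \<Rightarrow> nat" where "range F \<subseteq> E" "cantor_embedding F"
    using projection_contains_cantor_set[OF Z(1)] assms(2) unfolding Z(2) cantor_embedding_def by metis
  then show ?thesis
    using that by blast
qed

section \<open>Tight families are not analytic\<close>

lemma uncountableI_range:
  assumes "\<And>h :: nat \<Rightarrow> nat \<Rightarrow> nat. E \<subseteq> range h \<Longrightarrow> False"
  shows "uncountable (E :: (nat \<Rightarrow> nat) set)"
proof
  assume "countable E"
  show False
  proof (cases "E = {}")
    case False
    then show False
      using assms \<open>countable E\<close> by (metis order_refl range_from_nat_into)
  qed (use assms in blast)
qed

lemma uncountable_maximal_ed_family:
  assumes "maximal_ed_family E"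
  shows "uncountable E"
proof (rule uncountableI_range)
  fix h :: "nat \<Rightarrow> nat \<Rightarrow> nat"
  assume h: "E \<subseteq> range h"
  have "\<forall>k. \<exists>m. m \<notin> (\<lambda>i. h i k) ` {..k}"
    by (metis ex_new_if_finite finite_atMost finite_imageI infinite_UNIV_nat)
  \<comment> \<open>At place \<open>k\<close> only the values of \<open>h 0\<close>, ...,
    \<open>h k\<close> are avoided, which are finitely many; still \<open>f\<close> differs from
    \<open>h i\<close> from place \<open>i\<close> on.\<close>
  then obtain f where f: "\<And>k i. i \<le> k \<Longrightarrow> f k \<noteq> h i k"
    by (metis atMost_iff image_eqI)
  have "\<forall>n>i. f n \<noteq> h i n \<and> h i n \<noteq> f n" for i
    using f by (metis less_imp_le)
  then have diff: "ev_diff f e \<and> ev_diff e f" if "e \<in> E" for e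
    using h that unfolding ev_diff_def by blast
  \<comment> \<open>No function is eventually different from itself.\<close>
  then have "f \<notin> E"
    unfolding ev_diff_def by (metis lessI)
  moreover have "ed_family (insert f E)"
    using assms diff unfolding maximal_ed_family_def ed_family_def by blast
  ultimately show False
    using assms unfolding maximal_ed_family_def by blast
qed

text \<open>For an enumeration \<open>h\<close>, a node meets \<open>h j\<close> at no place from
  \<open>j\<close> on, so no \<open>h j\<close> can densely diagonalize this tree.\<close>

definition evading_tree :: "(nat \<Rightarrow> nat \<Rightarrow> 'a) \<Rightarrow> 'a list set" where
  "evading_tree h = {s. \<forall>k<length s. \<forall>i\<le>k. s ! k \<noteq> h i k}"

text \<open>Each level forbids only finitely many values, so a fresh one always exists. The set
  \<open>B\<close> leaves room for the values that a finite subfamily takes at place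
  \<open>n\<close>.\<close>

lemma evading_tree_extend:
  fixes h :: "nat \<Rightarrow> nat \<Rightarrow> nat"
  assumes "t \<in> evading_tree h" "length t \<le> n" "finite B"
  shows "\<exists>s \<in> evading_tree h. prefix t s \<and> length s = Suc n \<and> s ! n \<notin> B"
  using assms(2)
proof (induction n rule: dec_induct)
  have *: "\<exists>s \<in> evading_tree h. prefix t s \<and> length s = Suc n \<and> s ! n \<notin> B"
    if s: "s \<in> evading_tree h" "prefix t s" "length s = n" for s n
  proof -
    obtain m where m: "m \<notin> (\<lambda>i. h i n) ` {..n} \<union> B"
      using \<open>finite B\<close> by (metis ex_new_if_finite finite_UnI finite_atMost finite_imageI infinite_UNIV_nat)
    have "s @ [m] \<in> evading_tree h"
      using s m by (auto simp: evading_tree_def nth_append less_Suc_eq)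
    then show ?thesis
      using s m by (intro bexI[of _ "s @ [m]"]) (auto intro: prefix_order.order_trans)
  qed
  case base
  then show ?case
    using *[of t] assms(1) by blast
  case (step n)
  then show ?case
    using * by blast
qed

text \<open>Above any node and at every later place, some value escapes the finitely many functions
  in \<open>X\<close>. The uncovered part thus projects onto a final segment of the natural
  numbers.\<close>

lemma evading_tree_in_I_T_plus:
  assumes "E \<subseteq> range h"
  shows "evading_tree h \<in> I_T_plus E"
proof -
  have "is_tree (evading_tree h)"
    unfolding is_tree_def
  proof (intro conjI ballI allI impI)
    fix t s :: "nat list"
    assume "t \<in> evading_tree h" "prefix s t"
    then show "s \<in> evading_tree h"
      by (auto simp: evading_tree_def prefix_iff_nth)
  next
    fix t :: "nat list"
    assume "t \<in> evading_tree h"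
    then show "\<exists>s\<in>evading_tree h. strict_prefix t s"
      using evading_tree_extend[of t h "length t" "{}"] by (force simp: strict_prefix_def)
  qed
  moreover have False
    if t: "t \<in> evading_tree h" and X: "finite X" "X \<subseteq> E"
      and fin: "finite (\<Union> (seq_graph ` subtree_at (evading_tree h) t) - \<Union> (fun_graph ` X))" for t X
  proof -
    have "\<exists>p \<in> \<Union> (seq_graph ` subtree_at (evading_tree h) t) - \<Union> (fun_graph ` X). fst p = n"
      if "length t \<le> n" for n
    proof -
      obtain s where s: "s \<in> evading_tree h" "prefix t s" "length s = Suc n" "s ! n \<notin> (\<lambda>f. f n) ` X"
        using evading_tree_extend[OF t \<open>length t \<le> n\<close>] X(1) by blast
      then have "(n, s ! n) \<in> \<Union> (seq_graph ` subtree_at (evading_tree h) t) - \<Union> (fun_graph ` X)"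
        by (auto simp: subtree_at_def seq_graph_def fun_graph_def)
      then show ?thesis
        by (metis fst_conv)
    qed
    then have "{length t..} \<subseteq> fst ` (\<Union> (seq_graph ` subtree_at (evading_tree h) t) - \<Union> (fun_graph ` X))"
      by (metis (no_types, lifting) atLeast_iff image_iff subsetI)
    then show False
      using fin by (meson finite_imageI finite_subset infinite_Ici)
  qed
  ultimately show ?thesis
    unfolding I_T_plus_def by blast
qed

lemma tight_single_tree:
  assumes "tight E" "T \<in> I_T_plus E"
  obtains g where "g \<in> E" "densely_diagonalizes g T"
  using assms(1)[unfolded tight_def, THEN spec, of "{T}"] assms(2) by auto

lemma uncountable_tight:
  assumes "tight E"
  shows "uncountable E"
proof (rule uncountableI_range)
  fix h :: "nat \<Rightarrow> nat \<Rightarrow> nat"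
  assume h: "E \<subseteq> range h"
  obtain g where g: "g \<in> E" "densely_diagonalizes g (evading_tree h)"
    using tight_single_tree[OF assms evading_tree_in_I_T_plus[OF h]] .
  then obtain j where j: "g = h j"
    using h by blast
  have "[] \<in> evading_tree h"
    by (simp add: evading_tree_def)
  \<comment> \<open>A node of length \<open>Suc j\<close> pushes any agreement with
    \<open>h j\<close> to a place past \<open>j\<close>, where the tree forbids it.\<close>
  then obtain t where t: "t \<in> evading_tree h" "length t = Suc j"
    using evading_tree_extend[of "[]" h j "{}"] by auto
  then obtain s k where "s \<in> evading_tree h" "Suc j \<le> k" "k < length s" "s ! k = h j k"
    using g(2) unfolding densely_diagonalizes_def j by force
  then show False
    by (auto simp: evading_tree_def)
qed

section \<open>The tree of an embedded Cantor space\<close>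

definition tree_of :: "((nat \<Rightarrow> bool) \<Rightarrow> nat \<Rightarrow> 'a) \<Rightarrow> 'a list set" where
  "tree_of F = {init (F c) n | c n. True}"

lemma strict_prefix_init_Suc: "strict_prefix (init z n) (init z (Suc n))"
  by (simp add: init_Suc strict_prefix_def)

lemma tree_of_is_tree: "is_tree (tree_of F)"
  unfolding is_tree_def tree_of_def
  by (force simp: prefix_init_iff intro: strict_prefix_init_Suc)

lemma cantor_embedding_splits:
  assumes "cantor_embedding F"
  shows "infinite {F c' | c'. init (F c') n = init (F c) n}"
proof -
  \<comment> \<open>\<open>G k\<close> follows \<open>c\<close> below \<open>n\<close> and continues
    with the indicator of \<open>k\<close>. For \<open>k \<ge> n\<close> these are distinct, and by
    the Lipschitz modulus their images agree with \<open>F c\<close> below \<open>n\<close>.\<close>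
  define G where "G k = (\<lambda>i. if i < n then c i else i = k)" for k
  have "inj_on G {n..}"
    unfolding inj_on_def G_def by (metis atLeast_iff linorder_not_le)
  then have "inj_on (\<lambda>k. F (G k)) {n..}"
    using cantor_embedding_inj[OF assms] by (auto simp: inj_on_def)
  then have "infinite ((\<lambda>k. F (G k)) ` {n..})"
    using finite_imageD infinite_Ici by blast
  moreover have "init (F (G k)) n = init (F c) n" for k
  proof -
    have "F (G k) i = F c i" if "i < n" for i
      using assms that unfolding cantor_embedding_def
      by (auto simp: init_eq_iff G_def)
    then show ?thesis
      by (simp add: init_eq_iff)
  qed
  ultimately show ?thesis
    by (elim infinite_super[rotated]) auto
qed

text \<open>Infinitely many branches pass through a node, so one of them lies outside the finite set
  \<open>X\<close>. It belongs to \<open>E\<close>, hence is eventually different from each member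
  of \<open>X\<close>, and almost all of its graph stays uncovered.\<close>

lemma tree_of_in_I_T_plus:
  assumes F: "cantor_embedding F" and range: "range F \<subseteq> E" and ed: "ed_family E"
  shows "tree_of F \<in> I_T_plus E"
proof -
  have False
    if t: "t \<in> tree_of F" and X: "finite X" "X \<subseteq> E"
      and fin: "finite (\<Union> (seq_graph ` subtree_at (tree_of F) t) - \<Union> (fun_graph ` X))" for t X
  proof -
    obtain c n where t_eq: "t = init (F c) n"
      using t unfolding tree_of_def by blast
    have "infinite ({F c' | c'. init (F c') n = init (F c) n} - X)"
      using cantor_embedding_splits[OF F] X(1) by (simp add: Diff_infinite_finite)
    then have "{F c' | c'. init (F c') n = init (F c) n} - X \<noteq> {}"
      by (metis finite.emptyI)
    then obtain c' where c': "init (F c') n = init (F c) n" "F c' \<notin> X"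
      by blast
    have "\<exists>k. \<forall>i>k. F c' i \<noteq> f i" if "f \<in> X" for f
    proof -
      have "F c' \<in> E" "f \<in> E" "F c' \<noteq> f"
        using range X(2) c'(2) that by auto
      then have "ev_diff (F c') f"
        using ed by (simp add: ed_family_def)
      then show ?thesis
        by (simp add: ev_diff_def)
    qed
    then obtain K where K: "\<And>f i. f \<in> X \<Longrightarrow> i > K f \<Longrightarrow> F c' i \<noteq> f i"
      by metis
    have "(i, F c' i) \<in> \<Union> (seq_graph ` subtree_at (tree_of F) t) - \<Union> (fun_graph ` X)"
      if i: "i > Max (insert n (K ` X))" for i
    proof -
      \<comment> \<open>Beyond this maximum, \<open>i\<close> is past the node and past all
        thresholds; including \<open>n\<close> also keeps the set nonempty when \<open>X\<close> is
        empty.\<close>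
      have "i > n" "\<And>f. f \<in> X \<Longrightarrow> i > K f"
        using i X(1) by (auto simp: Max_less_iff)
      then have "init (F c') (Suc i) \<in> subtree_at (tree_of F) t"
        using c'(1) unfolding subtree_at_def tree_of_def t_eq
        by (auto simp: prefix_init_iff init_eq_iff)
      then have "(i, F c' i) \<in> \<Union> (seq_graph ` subtree_at (tree_of F) t)"
        unfolding seq_graph_def by force
      moreover have "(i, F c' i) \<notin> \<Union> (fun_graph ` X)"
        using K \<open>\<And>f. f \<in> X \<Longrightarrow> i > K f\<close> by (auto simp: fun_graph_def)
      ultimately show ?thesis
        by blast
    qed
    then have "{Max (insert n (K ` X))<..} \<subseteq>
        fst ` (\<Union> (seq_graph ` subtree_at (tree_of F) t) - \<Union> (fun_graph ` X))"
      by (intro subsetI) (rule image_eqI, rule fst_conv[symmetric], simp)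
    then show False
      using fin by (meson finite_imageI finite_subset infinite_Ioi)
  qed
  then show ?thesis
    unfolding I_T_plus_def using tree_of_is_tree by blast
qed

lemma cantor_limit:
  fixes c :: "nat \<Rightarrow> nat \<Rightarrow> 'a" and l :: "nat \<Rightarrow> nat"
  assumes "strict_mono l" and coh: "\<And>j. init (c (Suc j)) (l j) = init (c j) (l j)"
  obtains d where "\<And>j. init d (l j) = init (c j) (l j)"
proof -
  have coh': "init (c k) (l j) = init (c j) (l j)" if "j \<le> k" for j k
    using that
  proof (induction k rule: dec_induct)
    case (step k)
    have "l j \<le> l k"
      using step.hyps assms(1) by (simp add: strict_mono_less_eq)
    then show ?case
      using coh[of k] step.IH by (simp add: init_eq_iff)
  qed simp
  \<comment> \<open>Since \<open>l\<close> is strictly increasing, \<open>l (Suc i)\<close> exceeds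
    \<open>i\<close>, so place \<open>i\<close> is already frozen at stage
    \<open>Suc i\<close>.\<close>
  define d where "d i = c (Suc i) i" for i
  have "d i = c j i" if "i < l j" for i j
  proof -
    have "i < l (Suc i)"
      using strict_mono_imp_increasing[OF assms(1), of "Suc i"] by simp
    then show ?thesis
      unfolding d_def using that coh'[of j "Suc i"] coh'[of "Suc i" j]
      by (metis init_eq_iff nle_le)
  qed
  then show ?thesis
    using that[of d] by (simp add: init_eq_iff)
qed

text \<open>The point \<open>d\<close> is a limit of bit sequences. Each stage adds a later
  agreement with \<open>g\<close> and freezes enough bits to preserve it; a disagreement frozen at
  the start keeps the limit branch different from \<open>g\<close>.\<close>

lemma densely_diagonalizes_tree_of:
  assumes F: "cantor_embedding F" and g: "densely_diagonalizes g (tree_of F)"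
  obtains d where "F d \<noteq> g" "\<not> ev_diff (F d) g"
proof -
  have step: "\<exists>c' k. init c' l = init c l \<and> k \<ge> l \<and> F c' k = g k" for c l
  proof -
    obtain m where m: "\<And>c'. init (F c') m = init (F c) m \<Longrightarrow> init c' l = init c l"
      using F unfolding cantor_embedding_def by blast
    \<comment> \<open>Length \<open>m\<close> lets the continuous inverse recover the first
      \<open>l\<close> bits of \<open>c\<close>; length \<open>l\<close> makes the new agreement
      occur at \<open>l\<close> or later.\<close>
    have "init (F c) (max l m) \<in> tree_of F"
      unfolding tree_of_def by blast
    then obtain s k where s: "s \<in> tree_of F" "strict_prefix (init (F c) (max l m)) s"
        "max l m \<le> k" "k < length s" "s ! k = g k"
      using g unfolding densely_diagonalizes_def by (metis length_init)
    then obtain c' n where c': "s = init (F c') n"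
      unfolding tree_of_def by blast
    have "init (F c') m = init (F c) m"
      using s(2) unfolding c' strict_prefix_def by (simp add: prefix_init_iff init_eq_iff)
    then show ?thesis
      using m[of c'] s(3-5) unfolding c' by (intro exI[of _ c'] exI[of _ k]) simp
  qed
  \<comment> \<open>By injectivity at most one of two distinct bit sequences is mapped to
    \<open>g\<close>.\<close>
  obtain c0 where "F c0 \<noteq> g"
    using cantor_embedding_inj[OF F, of "\<lambda>_. True" "\<lambda>_. False"] by (metis fun_cong)
  then obtain n0 where n0: "F c0 n0 \<noteq> g n0"
    by blast
  \<comment> \<open>A state is a bit sequence with the number of its frozen bits. Freezing
    \<open>Suc n0\<close> bits fixes the value of the image at \<open>n0\<close>; later states use
    \<open>Suc k\<close> to fix the agreement at \<open>k\<close>.\<close>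
  have "\<exists>x. \<forall>j. (j = 0 \<longrightarrow> x j = (c0, Suc n0)) \<and>
      (init (fst (x (Suc j))) (snd (x j)) = init (fst (x j)) (snd (x j)) \<and>
      (\<exists>k\<ge>snd (x j). k < snd (x (Suc j)) \<and> F (fst (x (Suc j))) k = g k))"
  proof (rule dependent_nat_choice)
    fix x :: "(nat \<Rightarrow> bool) \<times> nat" and j :: nat
    obtain c' k where "init c' (snd x) = init (fst x) (snd x)" "k \<ge> snd x" "F c' k = g k"
      using step by blast
    then show "\<exists>y. (Suc j = 0 \<longrightarrow> y = (c0, Suc n0)) \<and>
        (init (fst y) (snd x) = init (fst x) (snd x) \<and> (\<exists>k\<ge>snd x. k < snd y \<and> F (fst y) k = g k))"
      by (intro exI[of _ "(c', Suc k)"]) auto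
  qed simp
  then obtain x where x0: "x 0 = (c0, Suc n0)"
    and x: "\<And>j. init (fst (x (Suc j))) (snd (x j)) = init (fst (x j)) (snd (x j))"
      "\<And>j. \<exists>k\<ge>snd (x j). k < snd (x (Suc j)) \<and> F (fst (x (Suc j))) k = g k"
    by blast
  have mono: "strict_mono (\<lambda>j. snd (x j))"
    unfolding strict_mono_Suc_iff using x(2) by (meson le_less_trans)
  obtain d where d: "\<And>j. init d (snd (x j)) = init (fst (x j)) (snd (x j))"
    using cantor_limit[OF mono, of "\<lambda>j. fst (x j)"] x(1) by blast
  have Fd: "F d k = F (fst (x j)) k" if "k < snd (x j)" for k j
    using F d[of j] that unfolding cantor_embedding_def by (auto simp: init_eq_iff)
  have "F d n0 \<noteq> g n0"
    using Fd[of n0 0] n0 by (simp add: x0)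
  moreover have "\<exists>k>j. F d k = g k" for j
  proof -
    have "Suc j \<le> snd (x (Suc j))"
      using strict_mono_imp_increasing[OF mono] by blast
    then show ?thesis
      using x(2)[of "Suc j"] Fd by (metis Suc_le_lessD le_less_trans less_le_trans)
  qed
  ultimately show ?thesis
    using that[of d] unfolding ev_diff_def by metis
qed

theorem tight_not_analytic:
  assumes "ed_family E" "tight E"
  shows "\<not> analytic_set E"
proof
  assume "analytic_set E"
  then obtain F where F: "cantor_embedding F" "range F \<subseteq> E"
    using analytic_perfect_set uncountable_tight[OF assms(2)] by blast
  obtain g where g: "g \<in> E" "densely_diagonalizes g (tree_of F)"
    using tight_single_tree[OF assms(2) tree_of_in_I_T_plus[OF F assms(1)]] .
  then obtain d where "F d \<noteq> g" "\<not> ev_diff (F d) g"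
    using densely_diagonalizes_tree_of[OF F(1)] by blast
  then show False
    using assms(1) F(2) g(1) unfolding ed_family_def by blast
qed

section \<open>The forcing relation\<close>

locale forcing =
  fixes P :: "'p set" and le :: "'p \<Rightarrow> 'p \<Rightarrow> bool"
  assumes forcing_notion: "forcing_notion P le"
begin

lemma le_refl: "p \<in> P \<Longrightarrow> le p p"
  using forcing_notion by (simp add: forcing_notion_def reflp_on_def)

lemma le_trans: "p \<in> P \<Longrightarrow> q \<in> P \<Longrightarrow> r \<in> P \<Longrightarrow> le p q \<Longrightarrow> le q r \<Longrightarrow> le p r"
  using forcing_notion unfolding forcing_notion_def transp_on_def by blast

definition ext :: "'p \<Rightarrow> 'p set" where
  "ext p = {q \<in> P. le q p}"

lemma ext_refl: "p \<in> P \<Longrightarrow> p \<in> ext p"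
  by (simp add: ext_def le_refl)

lemma ext_trans: "p \<in> P \<Longrightarrow> q \<in> ext p \<Longrightarrow> r \<in> ext q \<Longrightarrow> r \<in> ext p"
  unfolding ext_def using le_trans by blast

lemma ext_P: "q \<in> ext p \<Longrightarrow> q \<in> P"
  by (simp add: ext_def)

abbreviation val where "val \<equiv> forces_val P le"
abbreviation eq where "eq \<equiv> forces_eq P le"
abbreviation frc (infix "\<tturnstile>" 50) where "p \<tturnstile> \<phi> \<equiv> forces P le p \<phi>"

lemma val_iff: "val p n m x \<longleftrightarrow> (\<forall>q\<in>ext p. \<exists>r\<in>ext q. \<exists>s\<in>P. ((n, m), s) \<in> x \<and> le r s)"
  unfolding forces_val_def ext_def by blast

lemma eq_iff: "eq p x y \<longleftrightarrow> (\<forall>n m. \<forall>q\<in>ext p. val q n m x \<longleftrightarrow> val q n m y)"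
  unfolding forces_eq_def ext_def by blast

lemma forces_Mem: "p \<tturnstile> Mem x A \<longleftrightarrow>
    (\<forall>q\<in>ext p. \<exists>r\<in>ext q. \<exists>y. \<exists>s\<in>P. (y, s) \<in> A \<and> le r s \<and> eq r x y)"
  unfolding forces.simps forces_mem_def ext_def by blast

lemma forces_Neg: "p \<tturnstile> Neg \<phi> \<longleftrightarrow> (\<forall>q\<in>ext p. \<not> q \<tturnstile> \<phi>)"
  unfolding ext_def by auto

lemma val_mono: "val p n m x \<Longrightarrow> p \<in> P \<Longrightarrow> q \<in> ext p \<Longrightarrow> val q n m x"
  unfolding val_iff using ext_trans by blast

lemma eq_mono: "eq p x y \<Longrightarrow> p \<in> P \<Longrightarrow> q \<in> ext p \<Longrightarrow> eq q x y"
  unfolding eq_iff using ext_trans by blast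

lemma forces_mono: "p \<tturnstile> \<phi> \<Longrightarrow> p \<in> P \<Longrightarrow> q \<in> ext p \<Longrightarrow> q \<tturnstile> \<phi>"
proof (induction \<phi>)
  case (Val n m x)
  then show ?case
    using val_mono by simp
next
  case (Mem x A)
  then show ?case
    unfolding forces_Mem using ext_trans by blast
next
  case (Neg \<phi>)
  then show ?case
    unfolding forces_Neg using ext_trans by blast
qed auto

lemma val_dense:
  assumes "p \<in> P" "\<And>q. q \<in> ext p \<Longrightarrow> \<exists>r\<in>ext q. val r n m x"
  shows "val p n m x"
  unfolding val_iff
proof
  fix q
  assume q: "q \<in> ext p"
  then obtain r where r: "r \<in> ext q" "val r n m x"
    using assms(2) by blast
  then obtain r' where "r' \<in> ext r" "\<exists>s\<in>P. ((n, m), s) \<in> x \<and> le r' s"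
    using ext_refl ext_P unfolding val_iff by blast
  then show "\<exists>r\<in>ext q. \<exists>s\<in>P. ((n, m), s) \<in> x \<and> le r s"
    using ext_trans ext_P q r(1) by blast
qed

text \<open>Together with monotonicity, this allows a condition to be refined before a sentence is
  verified. The atomic clauses are already density statements, and for \<open>Neg\<close> a
  condition forcing the sentence would clash with a stronger one forcing its negation.\<close>

lemma forces_dense:
  assumes "p \<in> P" "\<And>q. q \<in> ext p \<Longrightarrow> \<exists>r\<in>ext q. r \<tturnstile> \<phi>"
  shows "p \<tturnstile> \<phi>"
  using assms
proof (induction \<phi> arbitrary: p)
  case (Ground b)
  then show ?case
    using ext_refl by auto
next
  case (Val n m x)
  then show ?case
    using val_dense by simp
next
  case (Mem x A)
  show ?case
    unfolding forces_Mem
  proof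
    fix q
    assume q: "q \<in> ext p"
    then obtain r where r: "r \<in> ext q" "r \<tturnstile> Mem x A"
      using Mem by blast
    then obtain r' where "r' \<in> ext r" "\<exists>y. \<exists>s\<in>P. (y, s) \<in> A \<and> le r' s \<and> eq r' x y"
      using ext_refl ext_P unfolding forces_Mem by blast
    then show "\<exists>r\<in>ext q. \<exists>y. \<exists>s\<in>P. (y, s) \<in> A \<and> le r s \<and> eq r x y"
      using ext_trans ext_P q r(1) by blast
  qed
next
  case (Neg \<phi>)
  have "\<not> q \<tturnstile> \<phi>" if q: "q \<in> ext p" for q
  proof
    assume "q \<tturnstile> \<phi>"
    obtain r where "r \<in> ext q" "r \<tturnstile> Neg \<phi>"
      using Neg.prems(2) q by blast
    then show False
      using forces_mono[OF \<open>q \<tturnstile> \<phi>\<close>] q ext_P ext_refl unfolding forces_Neg by blast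
  qed
  then show ?case
    unfolding forces_Neg by blast
next
  case (Conj \<phi> \<psi>)
  have "p \<tturnstile> \<phi>" "p \<tturnstile> \<psi>"
    using Conj.prems by (auto intro!: Conj.IH) (metis forces.simps(5))+
  then show ?case
    by simp
next
  case (All_nat \<Phi>)
  have "p \<tturnstile> \<Phi> n" for n
    by (rule All_nat.IH) (use All_nat.prems in fastforce)+
  then show ?case
    by simp
next
  case (All_real \<Phi>)
  have "p \<tturnstile> \<Phi> n" for n
    by (rule All_real.IH) (use All_real.prems in fastforce)+
  then show ?case
    by simp
next
  case (All_fam \<Phi>)
  have "p \<tturnstile> \<Phi> n" for n
    by (rule All_fam.IH) (use All_fam.prems in fastforce)+
  then show ?case
    by simp
qed

text \<open>The encoding by \<open>Neg\<close> and \<open>Conj\<close> says that no stronger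
  condition forces \<phi> together with \<open>Neg \<psi>\<close>. Hence \<psi> is forced densely
  below any condition forcing \<phi>, and density removes the double negation.\<close>

lemma forces_Imp:
  assumes "p \<in> P"
  shows "p \<tturnstile> Imp \<phi> \<psi> \<longleftrightarrow> (\<forall>q\<in>ext p. q \<tturnstile> \<phi> \<longrightarrow> q \<tturnstile> \<psi>)"
proof
  assume imp: "p \<tturnstile> Imp \<phi> \<psi>"
  show "\<forall>q\<in>ext p. q \<tturnstile> \<phi> \<longrightarrow> q \<tturnstile> \<psi>"
  proof (intro ballI impI)
    fix q
    assume q: "q \<in> ext p" "q \<tturnstile> \<phi>"
    show "q \<tturnstile> \<psi>"
    proof (rule forces_dense)
      show "q \<in> P"
        using q ext_P by blast
      fix r
      assume r: "r \<in> ext q"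
      then have "r \<tturnstile> \<phi>" "r \<in> ext p"
        using q forces_mono ext_P ext_trans assms by blast+
      then show "\<exists>r\<in>ext r. r \<tturnstile> \<psi>"
        using imp unfolding Imp_def forces_Neg forces.simps(5) by blast
    qed
  qed
next
  assume "\<forall>q\<in>ext p. q \<tturnstile> \<phi> \<longrightarrow> q \<tturnstile> \<psi>"
  then show "p \<tturnstile> Imp \<phi> \<psi>"
    unfolding Imp_def forces_Neg forces.simps(5) using ext_refl ext_P by blast
qed

lemma forces_Ex_nat: "p \<tturnstile> Ex_nat \<Phi> \<longleftrightarrow> (\<forall>q\<in>ext p. \<exists>r\<in>ext q. \<exists>n. r \<tturnstile> \<Phi> n)"
  unfolding Ex_nat_def forces_Neg forces.simps(6) by blast

lemma forces_Ex_real: "p \<tturnstile> Ex_real \<Phi> \<longleftrightarrow> (\<forall>q\<in>ext p. \<exists>r\<in>ext q. \<exists>x. r \<tturnstile> \<Phi> x)"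
  unfolding Ex_real_def forces_Neg forces.simps(7) by blast

lemma forces_Ex_fam: "p \<tturnstile> Ex_fam \<Phi> \<longleftrightarrow> (\<forall>q\<in>ext p. \<exists>r\<in>ext q. \<exists>A. r \<tturnstile> \<Phi> A)"
  unfolding Ex_fam_def forces_Neg forces.simps(8) by blast

lemma forces_Eq_real:
  assumes "p \<in> P"
  shows "p \<tturnstile> Eq_real x y \<longleftrightarrow> eq p x y"
  unfolding Eq_real_def forces.simps eq_iff forces_Imp[OF assms] by blast

lemma forces_Is_fun:
  assumes "p \<in> P"
  shows "p \<tturnstile> Is_fun x \<longleftrightarrow>
    (\<forall>n. (\<forall>q\<in>ext p. \<exists>r\<in>ext q. \<exists>m. val r n m x) \<and>
      (\<forall>m m'. \<forall>q\<in>ext p. val q n m x \<and> val q n m' x \<longrightarrow> m = m'))"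
  unfolding Is_fun_def forces.simps forces_Ex_nat forces_Imp[OF assms] ..

lemma forces_Ev_diff:
  assumes "p \<in> P"
  shows "p \<tturnstile> Ev_diff x y \<longleftrightarrow>
    (\<forall>q\<in>ext p. \<exists>r\<in>ext q. \<exists>k. \<forall>n>k. \<forall>m. \<forall>s\<in>ext r. \<not> (val s n m x \<and> val s n m y))"
proof -
  have "r \<tturnstile> Imp (Ground (k < n)) (All_nat (\<lambda>m. All_nat (\<lambda>m'. Imp (Conj (Val n m x) (Val n m' y))
      (Ground (m \<noteq> m'))))) \<longleftrightarrow>
    (k < n \<longrightarrow> (\<forall>m. \<forall>s\<in>ext r. \<not> (val s n m x \<and> val s n m y)))" (is "?L \<longleftrightarrow> ?R")
    if r: "r \<in> P" for r k n
  proof -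
    \<comment> \<open>The two quantified values \<open>m\<close> and \<open>m'\<close> collapse
      afterwards into one: a violation is a stronger condition forcing a common value.\<close>
    have "?L \<longleftrightarrow> (\<forall>q\<in>ext r. k < n \<longrightarrow>
        (\<forall>m m'. \<forall>s\<in>ext q. val s n m x \<and> val s n m' y \<longrightarrow> m \<noteq> m'))"
      unfolding forces_Imp[OF r] forces.simps using forces_Imp ext_P by fastforce
    also have "\<dots> \<longleftrightarrow> ?R"
      using ext_refl[OF r] ext_trans[OF r] by blast
    finally show ?thesis .
  qed
  then show ?thesis
    unfolding Ev_diff_def forces_Ex_nat forces.simps by (meson ext_P)
qed

text \<open>Membership in a family only provides a listed name that a stronger condition forces
  equal to the given one, so properties have to be transferred along forced equality.\<close>

lemma Is_fun_cong:
  assumes "p \<in> P" "eq p x x'" "p \<tturnstile> Is_fun x'"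
  shows "p \<tturnstile> Is_fun x"
  using assms(3) unfolding forces_Is_fun[OF assms(1)]
  by (meson assms(1,2) eq_iff ext_trans)

lemma Ev_diff_cong:
  assumes "p \<in> P" "eq p x x'" "eq p y y'" "p \<tturnstile> Ev_diff x' y'"
  shows "p \<tturnstile> Ev_diff x y"
  unfolding forces_Ev_diff[OF assms(1)]
proof
  fix q
  assume q: "q \<in> ext p"
  then obtain r k where r: "r \<in> ext q" "\<forall>n>k. \<forall>m. \<forall>s\<in>ext r. \<not> (val s n m x' \<and> val s n m y')"
    using assms(4) unfolding forces_Ev_diff[OF assms(1)] by blast
  have "s \<in> ext p" if "s \<in> ext r" for s
    using that q r(1) ext_trans ext_P assms(1) by blast
  then have "\<forall>n>k. \<forall>m. \<forall>s\<in>ext r. \<not> (val s n m x \<and> val s n m y)"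
    using r(2) assms(2,3) unfolding eq_iff by blast
  then show "\<exists>r\<in>ext q. \<exists>k. \<forall>n>k. \<forall>m. \<forall>s\<in>ext r. \<not> (val s n m x \<and> val s n m y)"
    using r(1) by blast
qed

lemma Ev_diff_sym: "p \<in> P \<Longrightarrow> p \<tturnstile> Ev_diff x y \<Longrightarrow> p \<tturnstile> Ev_diff y x"
  unfolding forces_Ev_diff by meson

section \<open>Names for ground model functions\<close>

lemma val_check_real:
  assumes "p \<in> P"
  shows "val p n m (check_real P f) \<longleftrightarrow> m = f n"
proof
  assume "val p n m (check_real P f)"
  then obtain s where "((n, m), s) \<in> check_real P f"
    unfolding val_iff using ext_refl[OF assms] by blast
  then show "m = f n"
    by (auto simp: check_real_def)
next
  assume "m = f n"
  then show "val p n m (check_real P f)"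
    unfolding val_iff check_real_def using ext_refl ext_P le_refl by blast
qed

lemma Is_fun_check_real:
  assumes "p \<in> P"
  shows "p \<tturnstile> Is_fun (check_real P f)"
  unfolding forces_Is_fun[OF assms]
proof (intro allI conjI ballI impI)
  fix n q
  assume "q \<in> ext p"
  then have "q \<in> P"
    by (rule ext_P)
  then show "\<exists>r\<in>ext q. \<exists>m. val r n m (check_real P f)"
    using ext_refl val_check_real by blast
qed (auto simp: val_check_real dest: ext_P)

lemma Ev_diff_check_real:
  assumes "p \<in> P" "ev_diff f g"
  shows "p \<tturnstile> Ev_diff (check_real P f) (check_real P g)"
  unfolding forces_Ev_diff[OF assms(1)]
proof
  fix q
  assume "q \<in> ext p"
  then have q: "q \<in> P"
    by (rule ext_P)
  obtain k where "\<forall>n>k. f n \<noteq> g n"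
    using assms(2) unfolding ev_diff_def by blast
  then have "\<forall>n>k. \<forall>m. \<forall>s\<in>ext q. \<not> (val s n m (check_real P f) \<and> val s n m (check_real P g))"
    by (auto simp: val_check_real dest: ext_P)
  then show "\<exists>r\<in>ext q. \<exists>k. \<forall>n>k. \<forall>m. \<forall>s\<in>ext r.
      \<not> (val s n m (check_real P f) \<and> val s n m (check_real P g))"
    using ext_refl[OF q] by blast
qed

lemma forces_Mem_check_fam:
  "p \<tturnstile> Mem x (check_fam P E) \<longleftrightarrow> (\<forall>q\<in>ext p. \<exists>r\<in>ext q. \<exists>f\<in>E. eq r x (check_real P f))"
proof -
  have "(\<exists>y. \<exists>s\<in>P. (y, s) \<in> check_fam P E \<and> le r s \<and> eq r x y) \<longleftrightarrow>
      (\<exists>f\<in>E. eq r x (check_real P f))" if "r \<in> P" for r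
    unfolding check_fam_def using that le_refl by blast
  then show ?thesis
    unfolding forces_Mem by (meson ext_P)
qed

text \<open>Countably many dense requirements are met one after another by dependent choice, as in
  the Rasiowa-Sikorski lemma. The sequence is not claimed to have a lower bound in
  \<open>P\<close>.\<close>

lemma fusion:
  assumes p: "p \<in> P" and D: "\<And>n q. q \<in> ext p \<Longrightarrow> \<exists>r\<in>ext q. D n r"
  obtains r :: "nat \<Rightarrow> 'p" where "r 0 \<in> ext p" "\<And>m n. m \<le> n \<Longrightarrow> r n \<in> ext (r m)" "\<And>n. D n (r n)"
proof -
  have "\<exists>r. \<forall>n. (r n \<in> ext p \<and> D n (r n)) \<and> r (Suc n) \<in> ext (r n)"
  proof (rule dependent_nat_choice)
    show "\<exists>x. x \<in> ext p \<and> D 0 x"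
      using D[OF ext_refl[OF p]] by blast
    show "\<exists>y. (y \<in> ext p \<and> D (Suc n) y) \<and> y \<in> ext x" if "x \<in> ext p \<and> D n x" for x n
      using that D ext_trans[OF p] by blast
  qed
  then obtain r where r: "\<And>n. r n \<in> ext p" "\<And>n. D n (r n)" "\<And>n. r (Suc n) \<in> ext (r n)"
    by blast
  have "r n \<in> ext (r m)" if "m \<le> n" for m n
    using that
  proof (induction n rule: dec_induct)
    case base
    then show ?case
      using r(1) ext_P ext_refl by blast
  next
    case (step n)
    then show ?case
      using r(1,3) ext_P ext_trans by blast
  qed
  then show ?thesis
    using that r by blast
qed

end

section \<open>The new member of the family\<close>

context forcing
begin

text \<open>\<open>F\<close> is applied to the graph of the new function, seen as an element of Cantor space by
  \<^const>\<open>prod_decode\<close>; thus bits are indexed by pairs \<open>(n, m)\<close>.\<close>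

fun decides :: "'p rname \<Rightarrow> 'p \<Rightarrow> nat \<times> nat \<Rightarrow> bool \<Rightarrow> bool" where
  "decides y r (n, m) True \<longleftrightarrow> val r n m y"
| "decides y r (n, m) False \<longleftrightarrow> (\<forall>q\<in>ext r. \<not> val q n m y)"

lemma decides_mono:
  assumes "r \<in> P" "decides y r nm b" "q \<in> ext r"
  shows "decides y q nm b"
  using assms by (cases "(y, r, nm, b)" rule: decides.cases) (auto intro: val_mono ext_trans)

lemma decides_unique:
  assumes "r \<in> P" "decides y r nm b" "decides y r nm b'"
  shows "b = b'"
  using assms ext_refl[OF assms(1)]
  by (cases nm; cases b; cases b') auto

text \<open>Excluding the negative decision below \<open>r\<close> makes the positive one dense, so
  it is forced by \<open>r\<close> itself; excluding the positive decision is literally the negative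
  one.\<close>

lemma decides_if_dense:
  assumes "r \<in> P" "\<And>q. q \<in> ext r \<Longrightarrow> \<not> decides y q nm (\<not> b)"
  shows "decides y r nm b"
proof (cases nm)
  case (Pair n m)
  show ?thesis
  proof (cases b)
    case True
    have "\<exists>s\<in>ext q. val s n m y" if "q \<in> ext r" for q
      using assms(2)[OF that] True by (simp add: Pair)
    then show ?thesis
      using val_dense[OF assms(1)] True by (simp add: Pair)
  next
    case False
    then show ?thesis
      using assms(2) by (simp add: Pair)
  qed
qed

lemma decides_dense:
  assumes "p \<in> P"
  shows "\<exists>r\<in>ext p. \<exists>b. decides y r nm b"
proof (cases "\<exists>r\<in>ext p. decides y r nm False")
  case False
  then have "decides y p nm True"
    using decides_if_dense[OF assms, of y nm True] by auto
  then show ?thesis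
    using ext_refl[OF assms] by blast
qed blast

text \<open>A total \<open>c\<close> stands for a finite string: only its first \<open>n\<close>
  bits matter.\<close>

definition decides_init :: "'p rname \<Rightarrow> 'p \<Rightarrow> (nat \<Rightarrow> bool) \<Rightarrow> nat \<Rightarrow> bool" where
  "decides_init y r c n \<longleftrightarrow> (\<forall>i<n. decides y r (prod_decode i) (c i))"

lemma decides_init_mono:
  "r \<in> P \<Longrightarrow> decides_init y r c n \<Longrightarrow> q \<in> ext r \<Longrightarrow> m \<le> n \<Longrightarrow> decides_init y q c m"
  unfolding decides_init_def using decides_mono by auto

lemma decides_init_unique:
  "r \<in> P \<Longrightarrow> decides_init y r c n \<Longrightarrow> decides_init y r c' n \<Longrightarrow> init c n = init c' n"
  unfolding decides_init_def init_eq_iff using decides_unique by blast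

lemma decides_init_dense:
  assumes "p \<in> P"
  shows "\<exists>r\<in>ext p. \<exists>c. decides_init y r c n"
proof (induction n)
  case 0
  then show ?case
    using ext_refl[OF assms] by (auto simp: decides_init_def)
next
  case (Suc n)
  then obtain r c where r: "r \<in> ext p" "decides_init y r c n"
    by blast
  obtain q b where q: "q \<in> ext r" "decides y q (prod_decode n) b"
    using decides_dense[OF ext_P[OF r(1)]] by blast
  have "decides_init y q (c(n := b)) (Suc n)"
    using decides_mono[OF ext_P[OF r(1)] _ q(1)] r(2) q(2)
    unfolding decides_init_def by (auto simp: less_Suc_eq)
  then show ?case
    using ext_trans[OF assms r(1) q(1)] by blast
qed

text \<open>Such a sequence plays the role of a generic filter, but lies in the ground model, as does the
  real \<open>c\<close> it determines. This replaces absoluteness: a \<open>\<Pi>\<close>-1-1 fact about the closed set \<open>range F\<close>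
  that fails in the extension already fails for \<open>F c\<close>.\<close>

lemma generic_branch:
  assumes p: "p \<in> P" and D: "\<And>n q. q \<in> ext p \<Longrightarrow> \<exists>r\<in>ext q. D n r"
  shows "\<exists>r c. \<forall>n. r n \<in> ext p \<and> D n (r n) \<and> decides_init y (r n) c n \<and> (\<forall>m\<le>n. r n \<in> ext (r m))"
proof -
  have "\<exists>r\<in>ext q. D n r \<and> (\<exists>c. decides_init y r c n)" if q: "q \<in> ext p" for n q
  proof -
    \<comment> \<open>The bits are decided before \<open>D n\<close> is met, because decisions
      persist to stronger conditions whereas \<open>D n\<close> need not.\<close>
    obtain s c where s: "s \<in> ext q" "decides_init y s c n"
      using decides_init_dense[OF ext_P[OF q]] by blast
    obtain r where r: "r \<in> ext s" "D n r"
      using D ext_trans[OF p q s(1)] by blast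
    have "decides_init y r c n"
      using decides_init_mono[OF ext_P[OF s(1)] s(2) r(1)] by simp
    then show ?thesis
      using r ext_trans[OF ext_P[OF q] s(1) r(1)] by blast
  qed
  then obtain r where r: "r 0 \<in> ext p" "\<And>m n. m \<le> n \<Longrightarrow> r n \<in> ext (r m)"
      "\<And>n. D n (r n) \<and> (\<exists>c. decides_init y (r n) c n)"
    using fusion[OF p, of "\<lambda>n r. D n r \<and> (\<exists>c. decides_init y r c n)"] by blast
  then obtain c where c: "\<And>n. decides_init y (r n) (c n) n"
    by metis
  \<comment> \<open>Stage \<open>Suc i\<close> is the first one guaranteed to decide bit
    \<open>i\<close>. Later conditions are stronger, so uniqueness of decisions makes the stages
    agree.\<close>
  define d where "d i = c (Suc i) i" for i
  have rp: "r n \<in> ext p" for n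
    using r(1) r(2)[of 0 n] ext_trans[OF p] by blast
  have "d i = c n i" if "i < n" for i n
  proof -
    have "decides_init y (r n) (c (Suc i)) (Suc i)"
      using decides_init_mono[OF ext_P[OF rp] c r(2)[of "Suc i" n]] that by simp
    moreover have "decides_init y (r n) (c n) (Suc i)"
      using decides_init_mono[OF ext_P[OF rp] c r(2)[of n n]] that by simp
    ultimately have "init (c (Suc i)) (Suc i) = init (c n) (Suc i)"
      using decides_init_unique[OF ext_P[OF rp]] by blast
    then show ?thesis
      by (simp add: init_eq_iff d_def)
  qed
  then have "decides_init y (r n) d n" for n
    using c[of n] by (simp add: decides_init_def)
  then show ?thesis
    using rp r(2,3) by blast
qed

text \<open>A name for the value of \<open>F\<close> at the bits of \<open>y\<close>. By the
  Lipschitz modulus, a condition deciding \<open>Suc n\<close> bits already determines the value at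
  \<open>n\<close>.\<close>

definition image_name :: "((nat \<Rightarrow> bool) \<Rightarrow> nat \<Rightarrow> nat) \<Rightarrow> 'p rname \<Rightarrow> 'p rname" where
  "image_name F y = {((n, F c n), q) | n c q. q \<in> P \<and> decides_init y q c (Suc n)}"

lemma val_image_name:
  assumes "r \<in> P" "decides_init y r c (Suc n)"
  shows "val r n (F c n) (image_name F y)"
  unfolding val_iff
proof
  fix q
  assume q: "q \<in> ext r"
  then have "((n, F c n), q) \<in> image_name F y"
    using decides_init_mono[OF assms q] ext_P[OF q] by (auto simp: image_name_def)
  then show "\<exists>s\<in>ext q. \<exists>t\<in>P. ((n, F c n), t) \<in> image_name F y \<and> le s t"
    by (intro bexI[of _ q] conjI le_refl ext_refl ext_P[OF q])
qed

context
  fixes F :: "(nat \<Rightarrow> bool) \<Rightarrow> nat \<Rightarrow> nat"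
  assumes F: "cantor_embedding F"
begin

lemma F_cong: "init c (Suc n) = init c' (Suc n) \<Longrightarrow> F c n = F c' n"
  using F unfolding cantor_embedding_def by blast

text \<open>The condition that contributed the pair and \<open>r\<close> have a common extension,
  where their decisions of the first \<open>Suc n\<close> bits coincide.\<close>

lemma val_image_nameD:
  assumes "r \<in> P" "decides_init y r c (Suc n)" "val r n m (image_name F y)"
  shows "m = F c n"
proof -
  obtain q s where q: "q \<in> ext r" "((n, m), s) \<in> image_name F y" "s \<in> P" "le q s"
    using assms(3) ext_refl[OF assms(1)] unfolding val_iff by blast
  then obtain c' where c': "m = F c' n" "decides_init y s c' (Suc n)"
    by (auto simp: image_name_def)
  have "q \<in> ext s"
    using ext_P[OF q(1)] q(4) by (simp add: ext_def)
  then have "decides_init y q c' (Suc n)"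
    using decides_init_mono[OF q(3) c'(2)] by blast
  moreover have "decides_init y q c (Suc n)"
    using decides_init_mono[OF assms(1,2) q(1)] by blast
  ultimately show ?thesis
    using F_cong decides_init_unique[OF ext_P[OF q(1)]] c'(1) by metis
qed

lemma image_name_dense:
  assumes "p \<in> P"
  shows "\<exists>r\<in>ext p. \<exists>m. val r n m (image_name F y)"
  using decides_init_dense[OF assms, of y "Suc n"] val_image_name ext_P by blast

lemma Is_fun_image_name:
  assumes "p \<in> P"
  shows "p \<tturnstile> Is_fun (image_name F y)"
  unfolding forces_Is_fun[OF assms]
proof (intro allI conjI ballI impI)
  fix n q
  assume "q \<in> ext p"
  then show "\<exists>r\<in>ext q. \<exists>m. val r n m (image_name F y)"
    using image_name_dense ext_P by blast
next
  fix n m m' q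
  assume q: "q \<in> ext p" and v: "val q n m (image_name F y) \<and> val q n m' (image_name F y)"
  have qP: "q \<in> P"
    using ext_P[OF q] .
  obtain r c where r: "r \<in> ext q" "decides_init y r c (Suc n)"
    using decides_init_dense[OF qP] by blast
  then have "m = F c n" "m' = F c n"
    using val_image_nameD[OF ext_P[OF r(1)] r(2)] v val_mono[OF _ qP r(1)] by blast+
  then show "m = m'"
    by simp
qed

text \<open>A condition deciding every bit of \<open>y\<close> knows the whole graph, which can then
  be read off in the ground model.\<close>

lemma Is_fun_imp_decided_not_new:
  assumes p: "p \<in> P" and y: "p \<tturnstile> Is_fun y" and c: "\<And>i. decides y p (prod_decode i) (c i)"
  shows "\<exists>g. eq p y (check_real P g)"
proof -
  have "\<exists>m. val p n m y" for n
  proof -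
    obtain r m where r: "r \<in> ext p" "val r n m y"
      using y ext_refl[OF p] unfolding forces_Is_fun[OF p] by blast
    \<comment> \<open>The value \<open>m\<close> is forced only by the stronger \<open>r\<close>,
      but the bit of \<open>(n, m)\<close> is already decided by \<open>p\<close>, so
      \<open>p\<close> must have decided it positively.\<close>
    have "decides y r (n, m) True" "decides y r (n, m) (c (prod_encode (n, m)))"
      using r c[of "prod_encode (n, m)"] decides_mono[OF p _ r(1)] by simp_all
    then have "c (prod_encode (n, m))"
      using decides_unique[OF ext_P[OF r(1)]] by blast
    then show ?thesis
      using c[of "prod_encode (n, m)"] by auto
  qed
  then obtain g where g: "\<And>n. val p n (g n) y"
    by metis
  have "val q n m y \<longleftrightarrow> m = g n" if q: "q \<in> ext p" for q n m
    using y g val_mono[OF g p q] q unfolding forces_Is_fun[OF p] by blast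
  then show ?thesis
    unfolding eq_iff using val_check_real ext_P by blast
qed

text \<open>If \<open>q\<close> forced the image to be the ground model function \<open>f\<close>,
  every branch obtained below \<open>q\<close> would be mapped to \<open>f\<close>. By injectivity
  there would be only one such branch, so \<open>q\<close> would decide all bits of
  \<open>y\<close>, contradicting that \<open>y\<close> is new.\<close>

lemma image_name_new:
  assumes p: "p \<in> P" and y: "p \<tturnstile> Is_fun y" "p \<tturnstile> Neg (Mem y (check_fam P UNIV))" and q: "q \<in> ext p"
  shows "\<not> eq q (image_name F y) (check_real P f)"
proof
  assume eq: "eq q (image_name F y) (check_real P f)"
  have qP: "q \<in> P"
    using ext_P[OF q] .
  have branch: "\<exists>c t. F c = f \<and> (\<forall>n. t n \<in> ext s \<and> decides_init y (t n) c n)" if s: "s \<in> ext q" for s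
  proof -
    have "\<exists>r\<in>ext q. True" if "q \<in> ext s" for q
      using ext_refl[OF ext_P[OF that]] by blast
    then obtain t c where t: "\<And>n. t n \<in> ext s" "\<And>n. decides_init y (t n) c n"
      using generic_branch[OF ext_P[OF s], of "\<lambda>_ _. True" y] by blast
    have "F c n = f n" for n
    proof -
      have "val (t (Suc n)) n (F c n) (image_name F y)"
        using val_image_name[OF ext_P[OF t(1)] t(2)] .
      then show ?thesis
        using eq ext_trans[OF qP s t(1)] val_check_real[OF ext_P[OF t(1)]]
        unfolding eq_iff by blast
    qed
    then show ?thesis
      using t by blast
  qed
  obtain c where c: "F c = f"
    using branch[OF ext_refl[OF qP]] by blast
  have "decides y q (prod_decode i) (c i)" for i
  \<comment> \<open>A condition \<open>s\<close> deciding the opposite bit would have below it a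
    branch with that bit, yet this branch is again \<open>c\<close>.\<close>
  proof (rule decides_if_dense[OF qP])
    fix s
    assume s: "s \<in> ext q"
    show "\<not> decides y s (prod_decode i) (\<not> c i)"
    proof
      assume neg: "decides y s (prod_decode i) (\<not> c i)"
      obtain c' t where c': "F c' = f" and t: "\<And>n. t n \<in> ext s" "\<And>n. decides_init y (t n) c' n"
        using branch[OF s] by blast
      have "c' = c"
        using cantor_embedding_inj[OF F] c c' by simp
      then have "decides y (t (Suc i)) (prod_decode i) (c i)"
        using t(2)[of "Suc i"] by (simp add: decides_init_def)
      then show False
        using decides_unique[OF ext_P[OF t(1)]] decides_mono[OF ext_P[OF s] neg t(1)] by blast
    qed
  qed
  then obtain g where "eq q y (check_real P g)"
    using Is_fun_imp_decided_not_new[OF qP forces_mono[OF y(1) p q]] by blast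
  then have "q \<tturnstile> Mem y (check_fam P UNIV)"
    unfolding forces_Mem_check_fam using eq_mono[OF _ qP] ext_refl ext_P by blast
  then show False
    using y(2) q unfolding forces_Neg by blast
qed

lemma image_name_not_in_check_fam:
  assumes "p \<in> P" "p \<tturnstile> Is_fun y" "p \<tturnstile> Neg (Mem y (check_fam P UNIV))"
  shows "p \<tturnstile> Neg (Mem (image_name F y) (check_fam P E))"
  unfolding forces_Neg
proof
  fix q
  assume q: "q \<in> ext p"
  show "\<not> q \<tturnstile> Mem (image_name F y) (check_fam P E)"
    unfolding forces_Mem_check_fam
    using image_name_new[OF assms] ext_refl[OF ext_P[OF q]] ext_trans[OF assms(1) q] by blast
qed

lemma Ev_diff_image_name:
  assumes p: "p \<in> P" and y: "p \<tturnstile> Is_fun y" "p \<tturnstile> Neg (Mem y (check_fam P UNIV))"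
    and E: "range F \<subseteq> E" "ed_family E" "e \<in> E"
  shows "p \<tturnstile> Ev_diff (image_name F y) (check_real P e)"
proof (rule ccontr)
  let ?x = "image_name F y"
  assume "\<not> ?thesis"
  \<comment> \<open>No condition below \<open>q\<close> bounds the agreements of the image with
    \<open>e\<close>.\<close>
  then obtain q where q: "q \<in> ext p"
    and no: "\<And>r k. r \<in> ext q \<Longrightarrow> \<exists>n>k. \<exists>m. \<exists>s\<in>ext r. val s n m ?x \<and> val s n m (check_real P e)"
    unfolding forces_Ev_diff[OF p] by blast
  have qP: "q \<in> P"
    using ext_P[OF q] .
  have hit: "\<exists>s\<in>ext r. \<exists>n>k. val s n (e n) ?x" if "r \<in> ext q" for r k
    using no[OF that, of k] val_check_real ext_P by metis
  \<comment> \<open>Otherwise \<open>q\<close> would force the image to equal \<open>e\<close>. The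
    disagreement obtained at \<open>n0\<close> guarantees that the ground model point
    \<open>F c\<close> found below differs from \<open>e\<close>.\<close>
  have "\<exists>r\<in>ext q. \<exists>n. \<exists>m. val r n m ?x \<and> m \<noteq> e n"
  proof (rule ccontr)
    assume same: "\<not> ?thesis"
    have val_e: "val r n (e n) ?x" if r: "r \<in> ext q" for r n
    proof (rule val_dense[OF ext_P[OF r]])
      fix s
      assume s: "s \<in> ext r"
      then obtain t m where "t \<in> ext s" "val t n m ?x"
        using image_name_dense[OF ext_P[OF s]] by blast
      then show "\<exists>t\<in>ext s. val t n (e n) ?x"
        using same ext_trans[OF qP r ext_trans[OF ext_P[OF r] s]] by metis
    qed
    then have "eq q ?x (check_real P e)"
      unfolding eq_iff using same val_check_real[OF ext_P] by metis
    then show False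
      using image_name_new[OF p y q] by blast
  qed
  then obtain r n0 m0 where r: "r \<in> ext q" "val r n0 m0 ?x" "m0 \<noteq> e n0"
    by blast
  have rP: "r \<in> P"
    using ext_P[OF r(1)] .
  have "\<exists>s'\<in>ext s. \<exists>n>k. val s' n (e n) ?x" if "s \<in> ext r" for s k
    using hit ext_trans[OF qP r(1) that] by blast
  then obtain t c where t: "\<forall>k. t k \<in> ext r \<and> (\<exists>n>k. val (t k) n (e n) ?x) \<and>
      decides_init y (t k) c k \<and> (\<forall>m\<le>k. t k \<in> ext (t m))"
    using generic_branch[OF rP, of "\<lambda>k s. \<exists>n>k. val s n (e n) ?x" y] by blast
  then have tP: "t k \<in> P" for k
    using ext_P by blast
  \<comment> \<open>Values forced anywhere along the sequence are values of \<open>F c\<close>: they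
    persist to a stage \<open>k > n\<close>, which decides the \<open>Suc n\<close> bits determining
    the value at \<open>n\<close>.\<close>
  have val_F: "m = F c n" if "s \<in> P" "val s n m ?x" "t k \<in> ext s" "n < k" for s n m k
  proof (rule val_image_nameD[OF tP])
    show "decides_init y (t k) c (Suc n)"
      using decides_init_mono[OF tP, of y k c k "t k"] t ext_refl[OF tP] that(4) by simp
    show "val (t k) n m ?x"
      using val_mono[OF that(2,1,3)] .
  qed
  have "F c n0 \<noteq> e n0"
    using val_F[OF rP r(2), of "Suc n0"] t r(3) by simp
  then have "F c \<noteq> e" "F c \<in> E"
    using E(1) by auto
  then have "ev_diff (F c) e"
    using E(2,3) by (simp add: ed_family_def)
  then obtain k where k: "\<And>n. n > k \<Longrightarrow> F c n \<noteq> e n"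
    unfolding ev_diff_def by blast
  obtain n where n: "n > k" "val (t k) n (e n) ?x"
    using t by blast
  \<comment> \<open>Stage \<open>Suc n\<close> is stronger than stage \<open>k\<close>, since
    \<open>k < n\<close>, and decides enough bits.\<close>
  have "e n = F c n"
    using val_F[OF tP n(2), of "Suc n"] t n(1) by simp
  then show False
    using k[OF n(1)] by simp
qed

end

section \<open>Adjoining a name to the family\<close>

definition adjoin_name :: "'p rname \<Rightarrow> 'p fname \<Rightarrow> 'p fname" where
  "adjoin_name x A = A \<union> {x} \<times> P"

lemma forces_Mem_adjoin_name:
  "p \<tturnstile> Mem z (adjoin_name x (check_fam P E)) \<longleftrightarrow>
    (\<forall>q\<in>ext p. \<exists>r\<in>ext q. eq r z x \<or> (\<exists>f\<in>E. eq r z (check_real P f)))"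
proof -
  have "(\<exists>y. \<exists>s\<in>P. (y, s) \<in> adjoin_name x (check_fam P E) \<and> le r s \<and> eq r z y) \<longleftrightarrow>
      eq r z x \<or> (\<exists>f\<in>E. eq r z (check_real P f))" if "r \<in> P" for r
    unfolding adjoin_name_def check_fam_def using that le_refl by blast
  then show ?thesis
    unfolding forces_Mem by (meson ext_P)
qed

text \<open>By density, conditions are refined until each of two given members is forced equal to
  \<open>x\<close> or to a specific ground model function. The mixed cases follow from
  \<open>diff\<close>, and the case of two ground functions from \<open>E\<close>.\<close>

lemma Ed_family_adjoin_name:
  assumes p: "p \<in> P" and x: "p \<tturnstile> Is_fun x" and E: "ed_family E"
    and diff: "\<And>e. e \<in> E \<Longrightarrow> p \<tturnstile> Ev_diff x (check_real P e)"
  shows "p \<tturnstile> Ed_family (adjoin_name x (check_fam P E))"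
proof -
  let ?B = "adjoin_name x (check_fam P E)"
  have "p \<tturnstile> Imp (Mem z ?B) (Is_fun z)" for z
    unfolding forces_Imp[OF p]
  proof (intro ballI impI)
    fix q
    assume q: "q \<in> ext p" "q \<tturnstile> Mem z ?B"
    show "q \<tturnstile> Is_fun z"
    proof (rule forces_dense[OF ext_P[OF q(1)]])
      fix r
      assume r: "r \<in> ext q"
      then obtain s where s: "s \<in> ext r" "eq s z x \<or> (\<exists>f\<in>E. eq s z (check_real P f))"
        using q(2) unfolding forces_Mem_adjoin_name by blast
      have sP: "s \<in> P" and sp: "s \<in> ext p"
        using s(1) r q(1) ext_P ext_trans p by blast+
      then have "s \<tturnstile> Is_fun z"
        using s(2) Is_fun_cong[OF sP] Is_fun_check_real[OF sP] forces_mono[OF x p sp] by blast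
      then show "\<exists>s\<in>ext r. s \<tturnstile> Is_fun z"
        using s(1) by blast
    qed
  qed
  moreover have "p \<tturnstile> Imp (Conj (Mem z ?B) (Mem w ?B)) (Imp (Neg (Eq_real z w)) (Ev_diff z w))" for z w
    unfolding forces_Imp[OF p]
  proof (intro ballI impI)
    fix q
    assume q: "q \<in> ext p" "q \<tturnstile> Conj (Mem z ?B) (Mem w ?B)"
    have qP: "q \<in> P"
      using ext_P[OF q(1)] .
    show "q \<tturnstile> Imp (Neg (Eq_real z w)) (Ev_diff z w)"
      unfolding forces_Imp[OF qP]
    proof (intro ballI impI)
      fix q'
      assume q': "q' \<in> ext q" "q' \<tturnstile> Neg (Eq_real z w)"
      show "q' \<tturnstile> Ev_diff z w"
      proof (rule forces_dense[OF ext_P[OF q'(1)]])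
        fix r
        assume r: "r \<in> ext q'"
        have rq: "r \<in> ext q"
          using ext_trans[OF qP q'(1) r] .
        obtain s where s: "s \<in> ext r" "eq s z x \<or> (\<exists>f\<in>E. eq s z (check_real P f))"
          using q(2) rq unfolding forces.simps(5) forces_Mem_adjoin_name by blast
        obtain t where t: "t \<in> ext s" "eq t w x \<or> (\<exists>f\<in>E. eq t w (check_real P f))"
          using q(2) ext_trans[OF qP rq s(1)]
          unfolding forces.simps(5) forces_Mem_adjoin_name by blast
        have tP: "t \<in> P" and tr: "t \<in> ext r" and tq': "t \<in> ext q'"
          using t(1) s(1) r q'(1) ext_P ext_trans by blast+
        have tp: "t \<in> ext p"
          using ext_trans[OF p q(1) ext_trans[OF qP q'(1) tq']] .
        have z: "eq t z x \<or> (\<exists>f\<in>E. eq t z (check_real P f))"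
          using s(2) eq_mono[OF _ ext_P[OF s(1)] t(1)] by blast
        have "\<not> eq t z w"
          using q'(2) tq' forces_Eq_real[OF tP] unfolding forces_Neg by blast
        \<comment> \<open>Two members equal to the same name would be forced equal. This rules out
          both being \<open>x\<close> and both being the same ground model function.\<close>
        then have ne: "\<not> (eq t z v \<and> eq t w v)" for v
          unfolding eq_iff by blast
        have xe: "t \<tturnstile> Ev_diff x (check_real P e)" "t \<tturnstile> Ev_diff (check_real P e) x" if "e \<in> E" for e
          using forces_mono[OF diff[OF that] p tp] Ev_diff_sym[OF tP] by blast+
        have ee: "t \<tturnstile> Ev_diff (check_real P e) (check_real P f)" if "e \<in> E" "f \<in> E" "e \<noteq> f" for e f
          using Ev_diff_check_real[OF tP] E that by (simp add: ed_family_def)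
        consider "eq t z x" "eq t w x" | e where "eq t z x" "e \<in> E" "eq t w (check_real P e)"
          | e where "e \<in> E" "eq t z (check_real P e)" "eq t w x"
          | e f where "e \<in> E" "eq t z (check_real P e)" "f \<in> E" "eq t w (check_real P f)"
          using z t(2) by blast
        then have "t \<tturnstile> Ev_diff z w"
        proof cases
          case 1
          then show ?thesis
            using ne by blast
        next
          case 2
          then show ?thesis
            using Ev_diff_cong[OF tP] xe(1) by blast
        next
          case 3
          then show ?thesis
            using Ev_diff_cong[OF tP] xe(2) by blast
        next
          case 4
          then have "e \<noteq> f"
            using ne by blast
          then show ?thesis
            using Ev_diff_cong[OF tP 4(2,4) ee[OF 4(1,3)]] by blast
        qed
        then show "\<exists>s\<in>ext r. s \<tturnstile> Ev_diff z w"
          using tr by blast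
      qed
    qed
  qed
  ultimately show ?thesis
    unfolding Ed_family_def by simp
qed

lemma Proper_subfam_adjoin_name:
  assumes p: "p \<in> P" and x: "p \<tturnstile> Neg (Mem x (check_fam P E))"
  shows "p \<tturnstile> Proper_subfam (check_fam P E) (adjoin_name x (check_fam P E))"
proof -
  have "p \<tturnstile> Imp (Mem z (check_fam P E)) (Mem z (adjoin_name x (check_fam P E)))" for z
    unfolding forces_Imp[OF p] forces_Mem_adjoin_name forces_Mem_check_fam by blast
  moreover have "q \<tturnstile> Conj (Mem x (adjoin_name x (check_fam P E))) (Neg (Mem x (check_fam P E)))"
    if q: "q \<in> ext p" for q
  proof -
    have "eq r x x" for r
      unfolding eq_iff by blast
    then have "q \<tturnstile> Mem x (adjoin_name x (check_fam P E))"
      unfolding forces_Mem_adjoin_name using ext_refl ext_P by blast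
    then show ?thesis
      using forces_mono[OF x p q] unfolding forces.simps(5) by blast
  qed
  then have "p \<tturnstile> Ex_real (\<lambda>x'. Conj (Mem x' (adjoin_name x (check_fam P E))) (Neg (Mem x' (check_fam P E))))"
    unfolding forces_Ex_real using ext_refl ext_P by blast
  ultimately show ?thesis
    unfolding Proper_subfam_def forces.simps(5,7) by blast
qed

text \<open>A condition forcing maximality could be strengthened to one that fixes a name
  \<open>y\<close> for a new function. There the family with the image of \<open>y\<close> adjoined
  is a proper eventually different extension.\<close>

theorem forced_not_maximal:
  assumes F: "cantor_embedding F" "range F \<subseteq> E" and E: "ed_family E" and new: "adds_new_real P le"
  shows "forced P le (Neg (Maximal_ed_family (check_fam P E)))"
  unfolding forced_def forces_Neg
proof (intro ballI notI)
  let ?A = "check_fam P E"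
  fix p q
  assume p: "p \<in> P" and q: "q \<in> ext p" and max: "q \<tturnstile> Maximal_ed_family ?A"
  have qP: "q \<in> P"
    using ext_P[OF q] .
  then have "q \<tturnstile> Ex_real (\<lambda>x. Conj (Is_fun x) (Neg (Mem x (check_fam P UNIV))))"
    using new unfolding adds_new_real_def forced_def by blast
  then obtain r y where r: "r \<in> ext q" "r \<tturnstile> Is_fun y" "r \<tturnstile> Neg (Mem y (check_fam P UNIV))"
    unfolding forces_Ex_real forces.simps(5) using ext_refl[OF qP] by blast
  have rP: "r \<in> P"
    using ext_P[OF r(1)] .
  define B where "B = adjoin_name (image_name F y) ?A"
  have B: "r \<tturnstile> Conj (Ed_family B) (Proper_subfam ?A B)"
    unfolding forces.simps(5) B_def
    using Ed_family_adjoin_name[OF rP Is_fun_image_name[OF F(1) rP] E]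
      Ev_diff_image_name[OF F(1) rP r(2,3) F(2) E]
      Proper_subfam_adjoin_name[OF rP image_name_not_in_check_fam[OF F(1) rP r(2,3)]] by blast
  have "r \<tturnstile> Ex_fam (\<lambda>B. Conj (Ed_family B) (Proper_subfam ?A B))"
    unfolding forces_Ex_fam using forces_mono[OF B rP] ext_refl ext_P by blast
  then show False
    using max r(1) unfolding Maximal_ed_family_def forces.simps(5) forces_Neg by blast
qed

end

theorem theorem3p3:
  shows "(\<forall>(E :: (nat \<Rightarrow> nat) set) (P :: 'p set) le.
            analytic_set E \<and> maximal_ed_family E \<and> forcing_notion P le \<and> adds_new_real P le
              \<longrightarrow> forced P le (Neg (Maximal_ed_family (check_fam P E))))
       \<and> (\<forall>E :: (nat \<Rightarrow> nat) set. ed_family E \<and> tight E \<longrightarrow> \<not> analytic_set E)"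
proof (intro conjI allI impI)
  fix E :: "(nat \<Rightarrow> nat) set" and P :: "'p set" and le
  assume *: "analytic_set E \<and> maximal_ed_family E \<and> forcing_notion P le \<and> adds_new_real P le"
  then interpret forcing P le
    by unfold_locales blast
  obtain F where "cantor_embedding F" "range F \<subseteq> E"
    using * analytic_perfect_set uncountable_maximal_ed_family by blast
  then show "forced P le (Neg (Maximal_ed_family (check_fam P E)))"
    using * forced_not_maximal unfolding maximal_ed_family_def by blast
next
  fix E :: "(nat \<Rightarrow> nat) set"
  assume "ed_family E \<and> tight E"
  then show "\<not> analytic_set E"
    using tight_not_analytic by blast
qed

end
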